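(* Let $\Omega>0$ and $\varepsilon\in(0,\Omega)$, and let the classes $\mathcal K$ (depending on $\Omega$), $\widehat{\mathcal K}$, $\mathcal M_L$, $\mathcal M_H$ (depending on $\Omega$ and $\varepsilon$), the frequency representation $X=\mathcal F x$ and the notion of uniform predictability be as defined in the context. Then the classes $\mathcal M_L$ and $\mathcal M_H$ are $L_\infty$-predictable in the weak sense uniformly with respect to the norm $\|\cdot\|_{C(\mathbf R)^*}$.
   Context: Notation. $i=\sqrt{-1}$ and $\mathbf C^+=\{z\in\mathbf C:\ \mathrm{Re}\, z>0\}$. For $k\in L_1(\mathbf R)$ or $L_2(\mathbf R)$, $(\mathcal F k)(i\omega)=\int_{-\infty}^{\infty}e^{-i\omega t}k(t)\,dt$, $\omega\in\mathbf R$. For $v\in L_2(\mathbf R)$ with $v(t)=0$ for $t<0$, $(\mathcal L v)(p)=\int_0^\infty e^{-pt}v(t)\,dt$, $p\in\mathbf C^+$. For $r\in[1,+\infty]$, $H^r$ is the Hardy space of functions $h$ holomorphic on $\mathbf C^+$ with finite norm $\|h\|_{H^r}=\sup_{s>0}\|h(s+i\,\cdot)\|_{L_r(\mathbf R)}$. Kernels. Fix $\Omega>0$. $\mathcal K$ is the class of functions $k:\mathbf R\to\mathbf R$ such that $k(t)=0$ for $t>0$ and such that $K=\mathcal F k$ has the form $K(i\omega)=d(i\omega)/\delta(i\omega)$, where $d$ and $\delta$ are polynomials with $\deg d<\deg\delta$, and such that if $\delta(p)=0$ for $p\in\mathbf C$, then $\mathrm{Re}\,p>0$ and $|\mathrm{Im}\,p|<\Omega$.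 $\widehat{\mathcal K}$ is the class of functions $\widehat k:\mathbf R\to\mathbf R$ such that $\widehat k(t)=0$ for $t<0$ and $\mathcal L\widehat k\in H^2\cap H^\infty$. Processes. $C(\mathbf R)$ is the Banach space of all bounded continuous functions $f:\mathbf R\to\mathbf C$ (sup norm), and $C(\mathbf R)^*$ is its dual space of continuous linear functionals. $\mathcal M_\infty$ is the class of all $x:\mathbf R\to\mathbf C$ for which there exist $X_c\in L_1(\mathbf R)$ (complex-valued), a sequence $\{\omega_k\}_{k=1}^\infty\subset\mathbf R$ and a sequence $\{c_k\}_{k=1}^\infty\subset\mathbf C$ with $\sum_{k=1}^\infty|c_k|<+\infty$ such that $$x(t)=\frac1{2\pi}\sum_{k=1}^\infty c_ke^{i\omega_kt}+\frac1{2\pi}\int_{-\infty}^{+\infty}e^{i\omega t}X_c(\omega)\,d\omega .$$ With $x\in\mathcal M_\infty$ one associates the (uniquely determined) element $X\in C(\mathbf R)^*$, denoted $X=\mathcal F x$, given by $$\langle f,X\rangle=\sum_{k=1}^\infty c_kf(\omega_k)+\int_{-\infty}^{+\infty}f(\omega)X_c(\omega)\,d\omega,\qquad f\in C(\mathbf R),$$ so that $x(t)=\langle\frac1{2\pi}e^{it\cdot},X\rangle$ for all $t$. $\|X\|_{C(\mathbf R)^*}$ denotes the norm of this functional. For the given $\varepsilon\in(0,\Omega)$: $\mathcal M_L$ is the set of $x\in\mathcal M_\infty$ (with representation $x(t)=\frac1{2\pi}\sum_{k=1}^\infty c_ke^{i\omega_kt}+\frac1{2\pi}\int_{-\infty}^{+\infty}e^{i\omega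 t}X_c(\omega)\,d\omega$, where $X_c\in L_1(\mathbf R)$, $\{\omega_k\}_{k=1}^\infty\subset\mathbf R$, $\{c_k\}_{k=1}^\infty\subset\mathbf C$ and $\sum_{k=1}^\infty|c_k|<+\infty$) such that $|\omega_k|\le\Omega-\varepsilon$ for all $k$ and $\mathrm{supp}\,X_c\subseteq[-\Omega+\varepsilon,\Omega-\varepsilon]$; $\mathcal M_H$ is the set of $x\in\mathcal M_\infty$ such that $|\omega_k|\ge\Omega+\varepsilon$ for all $k$ and $\mathrm{supp}\,X_c\subseteq(-\infty,-\Omega-\varepsilon]\cup[\Omega+\varepsilon,+\infty)$. Predictability. A class $\mathcal X\subset\mathcal M_\infty$ is $L_\infty$-predictable in the weak sense uniformly with respect to the norm $\|\cdot\|_{C(\mathbf R)^*}$ if, for any $k\in\mathcal K$ and any $\eta>0$, there exists $\widehat k\in\widehat{\mathcal K}$ (depending on $\mathcal X$, $k$, $\eta$ but not on $x$) such that $$\|y-\widehat y\|_{L_\infty(\mathbf R)}\le\eta\|X\|_{C(\mathbf R)^*}\qquad\text{for all }x\in\mathcal X,\ X=\mathcal F x,$$ where $y(t)=\int_t^{+\infty}k(t-s)x(s)\,ds$ and $\widehat y(t)=\int_{-\infty}^t\widehat k(t-s)x(s)\,ds$. *)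

theory Defs
  imports
    "HOL-Analysis.Analysis"
    "HOL-Probability.Essential_Supremum"
    "HOL-Computational_Algebra.Polynomial"
begin

definition L_norm :: "ereal \<Rightarrow> (real \<Rightarrow> 'a::{banach, second_countable_topology}) \<Rightarrow> ereal" where
  "L_norm r f =
     (if f \<notin> borel_measurable lebesgue then \<infinity>
      else if r = \<infinity> then esssup lebesgue (\<lambda>t. ereal (norm (f t)))
      else let I = (\<integral>\<^sup>+t. ennreal (norm (f t) powr real_of_ereal r) \<partial>lebesgue)
           in if I = \<infinity> then \<infinity> else ereal (enn2real I powr (1 / real_of_ereal r)))"

definition in_L :: "ereal \<Rightarrow> (real \<Rightarrow> 'a::{banach, second_countable_topology}) \<Rightarrow> bool" where
  "in_L r f \<longleftrightarrow> f \<in> borel_measurable lebesgue \<and> L_norm r f < \<infinity>"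

definition Hardy_norm :: "ereal \<Rightarrow> (complex \<Rightarrow> complex) \<Rightarrow> ereal" where
  "Hardy_norm r h = (SUP s\<in>{0::real<..}. L_norm r (\<lambda>w. h (Complex s w)))"

definition Hardy :: "ereal \<Rightarrow> (complex \<Rightarrow> complex) set" where
  "Hardy r = {h. h holomorphic_on {z. Re z > 0} \<and> Hardy_norm r h < \<infinity>}"

text \<open>For \<open>k\<close> in \<open>L\<^sub>1\<close> the transform is the absolutely convergent integral, taken at every frequency;
  for \<open>k\<close> in \<open>L\<^sub>2\<close> it is the usual \<open>L\<^sub>2\<close>-limit of the integrals over \<open>[-T, T]\<close>, hence determined only
  almost everywhere. Values on the imaginary axis are indexed by the real frequency.\<close>

definition has_fourier :: "(real \<Rightarrow> real) \<Rightarrow> (real \<Rightarrow> complex) \<Rightarrow> bool" where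
  "has_fourier k K \<longleftrightarrow>
     (in_L 1 k \<and>
       (\<forall>w. K w = (\<integral>t. exp (- \<i> * of_real (w * t)) * of_real (k t) \<partial>lebesgue))) \<or>
     (in_L 2 k \<and>
       ((\<lambda>T. L_norm 2 (\<lambda>w. K w -
           (LINT t:{-T..T}|lebesgue. exp (- \<i> * of_real (w * t)) * of_real (k t)))) \<longlongrightarrow> 0) at_top)"

definition laplace :: "(real \<Rightarrow> real) \<Rightarrow> complex \<Rightarrow> complex" where
  "laplace v p = (LINT t:{0..}|lebesgue. exp (- p * of_real t) * of_real (v t))"

definition anticausal_kernels :: "real \<Rightarrow> (real \<Rightarrow> real) set" where
  "anticausal_kernels \<Omega> = {k. (\<forall>t>0. k t = 0) \<and>
     (\<exists>d \<delta> :: complex poly. degree d < degree \<delta> \<and>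
        (\<forall>p. poly \<delta> p = 0 \<longrightarrow> Re p > 0 \<and> \<bar>Im p\<bar> < \<Omega>) \<and>
        has_fourier k (\<lambda>w. poly d (\<i> * of_real w) / poly \<delta> (\<i> * of_real w)))}"

text \<open>Membership in \<open>L\<^sub>2\<close> is what makes the Laplace transform defined on the right half-plane.\<close>

definition causal_kernels :: "(real \<Rightarrow> real) set" where
  "causal_kernels = {k. (\<forall>t<0. k t = 0) \<and> in_L 2 k \<and> laplace k \<in> Hardy 2 \<inter> Hardy \<infinity>}"

text \<open>\<open>represents \<omega> c Xc x\<close>: the process \<open>x\<close> has discrete spectrum \<open>c k\<close> at the frequencies \<open>\<omega> k\<close>
  and spectral density \<open>Xc\<close>; the sequences are indexed from 0.\<close>

definition represents ::
    "(nat \<Rightarrow> real) \<Rightarrow> (nat \<Rightarrow> complex) \<Rightarrow> (real \<Rightarrow> complex) \<Rightarrow> (real \<Rightarrow> complex) \<Rightarrow> bool" where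
  "represents \<omega> c Xc x \<longleftrightarrow>
     summable (\<lambda>k. norm (c k)) \<and> in_L 1 Xc \<and>
     (\<forall>t. x t = 1 / (2 * of_real pi) * (\<Sum>k. c k * exp (\<i> * of_real (\<omega> k * t)))
              + 1 / (2 * of_real pi) * (\<integral>w. exp (\<i> * of_real (w * t)) * Xc w \<partial>lebesgue))"

definition M_inf :: "(real \<Rightarrow> complex) set" where
  "M_inf = {x. \<exists>\<omega> c Xc. represents \<omega> c Xc x}"

text \<open>\<open>is_spectrum x X\<close>: the functional \<open>X\<close> on the bounded continuous functions is the one associated
  with \<open>x\<close>. The type of \<open>X\<close> only records real-linearity, but the defining formula is
  complex-linear, and the norm of such a functional does not depend on the scalar field.
  Existence of \<open>X\<close> is proved below.\<close>

definition is_spectrum :: "(real \<Rightarrow> complex) \<Rightarrow> ((real \<Rightarrow>\<^sub>C complex) \<Rightarrow>\<^sub>L complex) \<Rightarrow> bool" where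
  "is_spectrum x X \<longleftrightarrow>
     (\<exists>\<omega> c Xc. represents \<omega> c Xc x \<and>
        (\<forall>f. blinfun_apply X f =
           (\<Sum>k. c k * apply_bcontfun f (\<omega> k)) + (\<integral>w. apply_bcontfun f w * Xc w \<partial>lebesgue)))"

text \<open>Support of a function determined only almost everywhere: the complement of the largest open set
  on which it vanishes almost everywhere.\<close>

definition ess_support :: "(real \<Rightarrow> complex) \<Rightarrow> real set" where
  "ess_support f = - \<Union>{U. open U \<and> (AE w in lebesgue. w \<in> U \<longrightarrow> f w = 0)}"

definition M_low :: "real \<Rightarrow> real \<Rightarrow> (real \<Rightarrow> complex) set" where
  "M_low \<Omega> \<epsilon> = {x. \<exists>\<omega> c Xc. represents \<omega> c Xc x \<and>
     (\<forall>k. \<bar>\<omega> k\<bar> \<le> \<Omega> - \<epsilon>) \<and> ess_support Xc \<subseteq> {- \<Omega> + \<epsilon>..\<Omega> - \<epsilon>}}"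

definition M_high :: "real \<Rightarrow> real \<Rightarrow> (real \<Rightarrow> complex) set" where
  "M_high \<Omega> \<epsilon> = {x. \<exists>\<omega> c Xc. represents \<omega> c Xc x \<and>
     (\<forall>k. \<bar>\<omega> k\<bar> \<ge> \<Omega> + \<epsilon>) \<and> ess_support Xc \<subseteq> {..- \<Omega> - \<epsilon>} \<union> {\<Omega> + \<epsilon>..}}"

definition anticausal_conv :: "(real \<Rightarrow> real) \<Rightarrow> (real \<Rightarrow> complex) \<Rightarrow> real \<Rightarrow> complex" where
  "anticausal_conv k x t = (LINT s:{t..}|lebesgue. of_real (k (t - s)) * x s)"

definition causal_conv :: "(real \<Rightarrow> real) \<Rightarrow> (real \<Rightarrow> complex) \<Rightarrow> real \<Rightarrow> complex" where
  "causal_conv k x t = (LINT s:{..t}|lebesgue. of_real (k (t - s)) * x s)"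

text \<open>The integral is 0 by convention when the integrand is not integrable, so the
  convergence of both convolution integrals is part of the definition.\<close>

definition weakly_predictable :: "real \<Rightarrow> (real \<Rightarrow> complex) set \<Rightarrow> bool" where
  "weakly_predictable \<Omega> \<X> \<longleftrightarrow> \<X> \<subseteq> M_inf \<and>
     (\<forall>k\<in>anticausal_kernels \<Omega>. \<forall>\<eta>>0. \<exists>kh\<in>causal_kernels. \<forall>x\<in>\<X>.
        (\<forall>t. set_integrable lebesgue {t..} (\<lambda>s. of_real (k (t - s)) * x s) \<and>
             set_integrable lebesgue {..t} (\<lambda>s. of_real (kh (t - s)) * x s)) \<and>
        (\<forall>X. is_spectrum x X \<longrightarrow>
           L_norm \<infinity> (\<lambda>t. anticausal_conv k x t - causal_conv kh x t) \<le> ereal (\<eta> * norm X)))"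

lemma in_L_1_integrable:
  assumes "in_L 1 f"
  shows "integrable lebesgue f"
proof (rule integrableI_bounded)
  show "f \<in> borel_measurable lebesgue"
    using assms by (simp add: in_L_def)
  have "(\<integral>\<^sup>+t. ennreal (norm (f t) powr 1) \<partial>lebesgue) < \<infinity>"
    using assms by (auto simp: in_L_def L_norm_def Let_def top.not_eq_extremum split: if_splits)
  then show "(\<integral>\<^sup>+t. ennreal (norm (f t)) \<partial>lebesgue) < \<infinity>"
    by simp
qed

lemma ex_is_spectrum:
  assumes "x \<in> M_inf"
  shows "\<exists>X. is_spectrum x X"
proof -
  obtain \<omega> c Xc where r: "represents \<omega> c Xc x"
    using assms by (auto simp: M_inf_def)
  have c: "summable (\<lambda>k. norm (c k))" and Xc: "integrable lebesgue Xc"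
    using r in_L_1_integrable by (auto simp: represents_def)
  define F where "F f = (\<Sum>k. c k * apply_bcontfun f (\<omega> k)) + (\<integral>w. apply_bcontfun f w * Xc w \<partial>lebesgue)"
    for f :: "real \<Rightarrow>\<^sub>C complex"
  have le1: "norm (c k * apply_bcontfun f (\<omega> k)) \<le> norm (c k) * norm f" for f k
    by (simp add: norm_mult mult_left_mono norm_bounded)
  have s1: "summable (\<lambda>k. norm (c k * apply_bcontfun f (\<omega> k)))" for f
    by (rule summable_comparison_test'[OF summable_mult2[OF c, of "norm f"], of 0]) (use le1 in auto)
  have s: "summable (\<lambda>k. c k * apply_bcontfun f (\<omega> k))" for f
    using s1 by (rule summable_norm_cancel)
  have le2: "norm (apply_bcontfun f w * Xc w) \<le> norm f * norm (Xc w)" for f w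
    by (simp add: norm_mult mult_right_mono norm_bounded)
  have meas: "apply_bcontfun f \<in> borel_measurable lebesgue" for f :: "real \<Rightarrow>\<^sub>C complex"
  proof -
    have "continuous_on UNIV (apply_bcontfun f)"
      using apply_bcontfun[of f] by (simp add: bcontfun_def)
    then show ?thesis
      by (intro measurable_completion) (simp add: borel_measurable_continuous_onI)
  qed
  have i: "integrable lebesgue (\<lambda>w. apply_bcontfun f w * Xc w)" for f
  proof (rule Bochner_Integration.integrable_bound)
    show "integrable lebesgue (\<lambda>w. norm f * norm (Xc w))"
      using Xc by simp
    show "(\<lambda>w. apply_bcontfun f w * Xc w) \<in> borel_measurable lebesgue"
      using meas Xc by (intro borel_measurable_times) auto
    show "AE w in lebesgue. norm (apply_bcontfun f w * Xc w) \<le> norm (norm f * norm (Xc w))"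
      using le2 by simp
  qed
  have bd: "bounded_linear F"
  proof (rule bounded_linear_intro)
    show "F (f + g) = F f + F g" for f g
      using suminf_add[OF s s, of f g] Bochner_Integration.integral_add[OF i i, of f g]
      by (simp add: F_def algebra_simps)
    show "F (a *\<^sub>R f) = a *\<^sub>R F f" for a f
      using suminf_scaleR_right[OF s, of a f]
      by (simp add: F_def scaleR_add_right)
    show "norm (F f) \<le> norm f * ((\<Sum>k. norm (c k)) + (\<integral>w. norm (Xc w) \<partial>lebesgue))" for f
    proof -
      have "norm (\<Sum>k. c k * apply_bcontfun f (\<omega> k)) \<le> (\<Sum>k. norm (c k * apply_bcontfun f (\<omega> k)))"
        by (rule summable_norm[OF s1])
      also have "\<dots> \<le> (\<Sum>k. norm (c k) * norm f)"
        by (rule suminf_le[OF le1 s1 summable_mult2[OF c]])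
      also have "\<dots> = norm f * (\<Sum>k. norm (c k))"
        using suminf_mult2[OF c, of "norm f"] by (simp add: mult.commute)
      finally have 1: "norm (\<Sum>k. c k * apply_bcontfun f (\<omega> k)) \<le> norm f * (\<Sum>k. norm (c k))" .
      have "norm (\<integral>w. apply_bcontfun f w * Xc w \<partial>lebesgue) \<le> (\<integral>w. norm f * norm (Xc w) \<partial>lebesgue)"
        by (rule order_trans[OF integral_norm_bound integral_mono]) (use i Xc le2 in auto)
      then have 2: "norm (\<integral>w. apply_bcontfun f w * Xc w \<partial>lebesgue) \<le> norm f * (\<integral>w. norm (Xc w) \<partial>lebesgue)"
        by simp
      show ?thesis
        unfolding F_def using norm_triangle_mono[OF 1 2] by (simp add: distrib_left)
    qed
  qed
  have "is_spectrum x (Blinfun F)"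
    unfolding is_spectrum_def using r by (auto simp: bounded_linear_Blinfun_apply[OF bd] F_def)
  then show ?thesis ..
qed

end

theory Submission
  imports Defs "HOL-Probability.Probability" "HOL-Computational_Algebra.Fundamental_Theorem_Algebra"
begin

text \<open>A process in either class is a superposition of oscillations \<open>exp (\<i> * w * t)\<close> whose frequencies
\<open>w\<close> lie in \<open>D = {w. \<epsilon> \<le> \<bar>\<bar>w\<bar> - \<Omega>\<bar>}\<close>. A convolution multiplies each oscillation by the Fourier
transform of its kernel. Hence \<open>y - yh\<close> is the superposition with amplitudes multiplied by
\<open>K - Kh\<close>, and it is small compared with the norm of the spectrum as soon as \<open>K - Kh\<close> is small on
\<open>D\<close>. What has to be shown is that the transform \<open>K\<close> of an anticausal kernel can be approximated
uniformly on \<open>D\<close> by transforms \<open>Kh\<close> of causal kernels. A single \<open>Kh\<close> then serves both classes.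

The approximation is an instance of Runge's theorem. The causal kernels \<open>t\<^sup>j exp (- t) / j!\<close> have the
transforms \<open>1 / (1 + p)\<^sup>j\<^sup>+\<^sup>1\<close>, so the available functions are the polynomials in \<open>1 / (1 + p)\<close>
without constant term. Their uniform limits on \<open>D\<close> form an algebra \<open>causal_approx D\<close>. If this
algebra contains \<open>1 / (p - b)\<close>, a geometric series shows that it also contains \<open>1 / (p - b')\<close> for
all \<open>b'\<close> near \<open>b\<close>, and how near depends only on the distance of \<open>b\<close> from the frequencies
\<open>\<i> * D\<close>. The pole \<open>- 1\<close> can therefore be pushed along any path avoiding \<open>\<i> * D\<close>. The set \<open>D\<close> has a
gap around \<open>\<Omega>\<close>, so the path may cross the imaginary axis at \<open>\<i> * \<Omega>\<close> and reach every point
of the right half-plane (\<open>causal_approx_pole\<close>). Rational functions vanishing at infinity are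
generated by their simple poles (\<open>rational_induct\<close>), so \<open>K\<close> belongs to the algebra.

Two points need analysis. First, the spectrum \<open>X\<close> may come from another representation of \<open>x\<close> than
the one supported in \<open>D\<close>. The bound by the norm of \<open>X\<close> uses that \<open>x\<close> determines the functional:
pairings with oscillations determine the pairings with Gaussians, hence with mollified functions,
hence with all bounded continuous functions (\<open>pairing_unique\<close>). Secondly, the transform of the
anticausal kernel may be given only as an \<open>L\<^sub>2\<close>-limit, while the convolution integrals require an
integrable kernel. The rational function \<open>K\<close> is the transform of some integrable \<open>k0\<close>, a
combination of convolutions of exponentials, and testing against Gaussians identifies \<open>k\<close> with
\<open>k0\<close> almost everywhere (\<open>has_fourier_imp_integrable\<close>).\<close>

section \<open>Uniform approximation of rational functions by causal transforms\<close>

text \<open>Partial fractions in the form of an induction principle. Splitting off one linear factor \<open>p - a\<close> of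
the denominator, \<open>d / \<delta>\<close> becomes \<open>q / \<delta>' + d(a) / ((p - a) \<delta>')\<close>, and both terms are built from
smaller denominators. Because products are allowed, multiple poles need no separate treatment.
The principle is used for the algebra of transforms of integrable functions and for the algebra of
functions approximable by causal transforms.\<close>

lemma rational_induct:
  fixes d \<delta> :: "complex poly" and S :: "(real \<Rightarrow> complex) set"
  assumes add: "\<And>f g. f \<in> S \<Longrightarrow> g \<in> S \<Longrightarrow> (\<lambda>w. f w + g w) \<in> S"
    and smult: "\<And>f c. f \<in> S \<Longrightarrow> (\<lambda>w. c * f w) \<in> S"
    and mult: "\<And>f g. f \<in> S \<Longrightarrow> g \<in> S \<Longrightarrow> (\<lambda>w. f w * g w) \<in> S"
    and pole: "\<And>a. poly \<delta> a = 0 \<Longrightarrow> (\<lambda>w. 1 / (\<i> * of_real w - a)) \<in> S"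
    and off_axis: "\<And>w. poly \<delta> (\<i> * of_real w) \<noteq> 0"
    and deg: "degree d < degree \<delta>"
  shows "(\<lambda>w. poly d (\<i> * of_real w) / poly \<delta> (\<i> * of_real w)) \<in> S"
  using pole off_axis deg
proof (induction "degree \<delta>" arbitrary: d \<delta>)
  case 0
  then show ?case by simp
next
  case (Suc n)
  have "\<not> constant (poly \<delta>)"
    using Suc.hyps(2) by (simp add: constant_degree)
  then obtain a where a: "poly \<delta> a = 0"
    using fundamental_theorem_of_algebra by blast
  then obtain \<delta>' where \<delta>: "\<delta> = [:- a, 1:] * \<delta>'"
    by (auto simp: poly_eq_0_iff_dvd)
  have nz: "\<delta>' \<noteq> 0" using Suc.hyps(2) \<delta> by auto
  have deg': "degree \<delta>' = n"
    using Suc.hyps(2) nz unfolding \<delta> by (subst (asm) degree_mult_eq) auto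
  have fac: "poly \<delta> p = (p - a) * poly \<delta>' p" for p by (simp add: \<delta> algebra_simps)
  have ax: "\<i> * of_real w - a \<noteq> 0" "poly \<delta>' (\<i> * of_real w) \<noteq> 0" for w
    using Suc.prems(2)[of w] by (auto simp: fac)
  have pole_a: "(\<lambda>w. 1 / (\<i> * of_real w - a)) \<in> S"
    using Suc.prems(1) a by blast
  have pole': "(\<lambda>w. 1 / (\<i> * of_real w - b)) \<in> S" if "poly \<delta>' b = 0" for b
    using Suc.prems(1)[of b] that by (simp add: fac)
  have IH: "(\<lambda>w. poly e (\<i> * of_real w) / poly \<delta>' (\<i> * of_real w)) \<in> S" if "degree e < degree \<delta>'" for e
    using Suc.hyps(1)[of \<delta>' e] deg' pole' ax(2) that by blast
  define q where "q = synthetic_div d a"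
  have d: "poly d p = poly q p * (p - a) + poly d a" for p
    using arg_cong[OF synthetic_div_correct'[of a d], of "\<lambda>r. poly r p"] by (simp add: q_def algebra_simps)
  have deg_q: "degree q = degree d - 1"
    by (simp add: q_def degree_synthetic_div)
  show ?case
  proof (cases n)
    case 0
    obtain c where c: "\<delta>' = [:c:]" using deg' 0 degree_eq_zeroE by blast
    have "degree d = 0" using Suc.prems(3) Suc.hyps(2) 0 by simp
    then obtain e where e: "d = [:e:]" by (rule degree_eq_zeroE)
    show ?thesis
      using smult[OF pole_a, of "e / c"] by (simp add: fac c e mult.commute)
  next
    case (Suc m)
    have "degree q < degree \<delta>'"
      using Suc.prems(3) Suc.hyps(2) Suc deg' deg_q by auto
    then have 1: "(\<lambda>w. poly q (\<i> * of_real w) / poly \<delta>' (\<i> * of_real w)) \<in> S"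
      by (rule IH)
    have 2: "(\<lambda>w. 1 / poly \<delta>' (\<i> * of_real w)) \<in> S"
      using IH[of 1] Suc deg' by simp
    have "poly d (\<i> * of_real w) / poly \<delta> (\<i> * of_real w) =
        poly q (\<i> * of_real w) / poly \<delta>' (\<i> * of_real w)
        + poly d a * (1 / (\<i> * of_real w - a) * (1 / poly \<delta>' (\<i> * of_real w)))" for w
      using ax[of w] unfolding fac d[of "\<i> * of_real w"] by (simp add: divide_simps)
    then show ?thesis
      using add[OF 1 smult[OF mult[OF pole_a 2], of "poly d a"]] by simp
  qed
qed

text \<open>The functions on the imaginary axis, indexed by frequency, which are uniform limits on \<open>D\<close> of
polynomials in \<open>1 / (1 + p)\<close> without constant term. The missing constant term makes the
approximants decay at infinity, as the transforms of integrable kernels do.\<close>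

definition causal_approx :: "real set \<Rightarrow> (real \<Rightarrow> complex) set" where
  "causal_approx D = {G. \<forall>e>0. \<exists>q :: complex poly. \<forall>w\<in>D.
     norm (G w - poly q (1 / (1 + \<i> * of_real w)) / (1 + \<i> * of_real w)) \<le> e}"

lemma norm_1_plus_ii: "1 \<le> norm (1 + \<i> * complex_of_real w)"
  using abs_Re_le_cmod[of "1 + \<i> * complex_of_real w"] by simp

lemma one_plus_ii_nonzero [simp]: "1 + \<i> * complex_of_real w \<noteq> 0"
  using norm_1_plus_ii[of w] by auto

lemma causal_poly_bounded:
  fixes q :: "complex poly"
  obtains B where "\<And>w. norm (poly q (1 / (1 + \<i> * of_real w)) / (1 + \<i> * of_real w)) \<le> B" "B > 0"
proof -
  obtain B where B: "B > 0" "\<And>z. norm z \<le> 1 \<Longrightarrow> norm (poly q z) \<le> B"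
    using poly_bound_exists[of 1 q] by blast
  have "norm (poly q (1 / (1 + \<i> * of_real w)) / (1 + \<i> * of_real w)) \<le> B" for w
  proof -
    have "norm (1 / (1 + \<i> * complex_of_real w)) \<le> 1"
      using norm_1_plus_ii[of w] by (simp add: norm_divide divide_le_eq)
    then have "norm (poly q (1 / (1 + \<i> * of_real w))) / norm (1 + \<i> * complex_of_real w) \<le> B / 1"
      using norm_1_plus_ii[of w] B by (intro frac_le) auto
    then show ?thesis by (simp add: norm_divide)
  qed
  then show ?thesis using that B(1) by blast
qed

lemma causal_approxE:
  assumes "G \<in> causal_approx D" and "e > 0"
  obtains q :: "complex poly"
  where "\<And>w. w \<in> D \<Longrightarrow> norm (G w - poly q (1 / (1 + \<i> * of_real w)) / (1 + \<i> * of_real w)) \<le> e"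
  using assms unfolding causal_approx_def by blast

lemma causal_approx_bounded:
  assumes "G \<in> causal_approx D"
  obtains B where "\<And>w. w \<in> D \<Longrightarrow> norm (G w) \<le> B" "B > 0"
proof -
  obtain q where q: "\<And>w. w \<in> D \<Longrightarrow> norm (G w - poly q (1 / (1 + \<i> * of_real w)) / (1 + \<i> * of_real w)) \<le> 1"
    by (rule causal_approxE[OF assms, of 1]) auto
  obtain B where B: "\<And>w. norm (poly q (1 / (1 + \<i> * of_real w)) / (1 + \<i> * of_real w)) \<le> B" "B > 0"
    using causal_poly_bounded by blast
  have "norm (G w) \<le> 1 + B" if "w \<in> D" for w
    using q[OF that] B(1)[of w] norm_triangle_sub[of "G w" "poly q (1 / (1 + \<i> * of_real w)) / (1 + \<i> * of_real w)"] by linarith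
  then show ?thesis using that[of "1 + B"] B(2) by simp
qed

lemma causal_approx_poly:
  "(\<lambda>w. poly q (1 / (1 + \<i> * of_real w)) / (1 + \<i> * of_real w)) \<in> causal_approx D"
  unfolding causal_approx_def by (intro CollectI allI impI exI[of _ q]) simp

lemma causal_approx_closed:
  assumes "\<And>e. e > 0 \<Longrightarrow> \<exists>F\<in>causal_approx D. \<forall>w\<in>D. norm (G w - F w) \<le> e"
  shows "G \<in> causal_approx D"
  unfolding causal_approx_def
proof (intro CollectI allI impI)
  fix e :: real assume "e > 0"
  then obtain F where F: "F \<in> causal_approx D" "\<forall>w\<in>D. norm (G w - F w) \<le> e / 2"
    using assms[of "e / 2"] by auto
  obtain q where q: "\<And>w. w \<in> D \<Longrightarrow> norm (F w - poly q (1 / (1 + \<i> * of_real w)) / (1 + \<i> * of_real w)) \<le> e / 2"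
    by (rule causal_approxE[OF F(1), of "e / 2"]) (use \<open>e > 0\<close> in auto)
  show "\<exists>q. \<forall>w\<in>D. norm (G w - poly q (1 / (1 + \<i> * of_real w)) / (1 + \<i> * of_real w)) \<le> e"
  proof (intro exI[of _ q] ballI)
    fix w assume "w \<in> D"
    then show "norm (G w - poly q (1 / (1 + \<i> * of_real w)) / (1 + \<i> * of_real w)) \<le> e"
      using F(2) q norm_triangle_mono[of "G w - F w" "e / 2" "F w - poly q (1 / (1 + \<i> * of_real w)) / (1 + \<i> * of_real w)" "e / 2"]
      by simp
  qed
qed

lemma causal_approx_add:
  assumes "F \<in> causal_approx D" "G \<in> causal_approx D"
  shows "(\<lambda>w. F w + G w) \<in> causal_approx D"
  unfolding causal_approx_def
proof (intro CollectI allI impI)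
  fix e :: real assume "e > 0"
  then have e: "e / 2 > 0" by simp
  obtain q where q: "\<And>w. w \<in> D \<Longrightarrow> norm (F w - poly q (1 / (1 + \<i> * of_real w)) / (1 + \<i> * of_real w)) \<le> e / 2"
    using causal_approxE[OF assms(1) e] by blast
  obtain r where r: "\<And>w. w \<in> D \<Longrightarrow> norm (G w - poly r (1 / (1 + \<i> * of_real w)) / (1 + \<i> * of_real w)) \<le> e / 2"
    using causal_approxE[OF assms(2) e] by blast
  show "\<exists>q. \<forall>w\<in>D. norm (F w + G w - poly q (1 / (1 + \<i> * of_real w)) / (1 + \<i> * of_real w)) \<le> e"
  proof (intro exI[of _ "q + r"] ballI)
    fix w assume "w \<in> D"
    then show "norm (F w + G w - poly (q + r) (1 / (1 + \<i> * of_real w)) / (1 + \<i> * of_real w)) \<le> e"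
      using norm_triangle_mono[OF q r, of w w]
      by (simp add: add_divide_distrib algebra_simps)
  qed
qed

lemma causal_approx_smult:
  assumes "F \<in> causal_approx D"
  shows "(\<lambda>w. c * F w) \<in> causal_approx D"
  unfolding causal_approx_def
proof (intro CollectI allI impI)
  fix e :: real assume "e > 0"
  then have "e / (norm c + 1) > 0" by (intro divide_pos_pos) (auto intro: add_nonneg_pos)
  then obtain q where q: "\<And>w. w \<in> D \<Longrightarrow> norm (F w - poly q (1 / (1 + \<i> * of_real w)) / (1 + \<i> * of_real w)) \<le> e / (norm c + 1)"
    using causal_approxE[OF assms] by blast
  show "\<exists>q. \<forall>w\<in>D. norm (c * F w - poly q (1 / (1 + \<i> * of_real w)) / (1 + \<i> * of_real w)) \<le> e"
  proof (intro exI[of _ "smult c q"] ballI)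
    fix w assume w: "w \<in> D"
    have "norm (c * F w - poly (smult c q) (1 / (1 + \<i> * of_real w)) / (1 + \<i> * of_real w))
        = norm c * norm (F w - poly q (1 / (1 + \<i> * of_real w)) / (1 + \<i> * of_real w))"
      by (simp flip: norm_mult add: algebra_simps)
    also have "\<dots> \<le> (norm c + 1) * (e / (norm c + 1))"
      using q w \<open>e > 0\<close> by (intro mult_mono) auto
    also have "\<dots> = e" using norm_ge_zero[of c] by (simp add: add_nonneg_eq_0_iff)
    finally show "norm (c * F w - poly (smult c q) (1 / (1 + \<i> * of_real w)) / (1 + \<i> * of_real w)) \<le> e" .
  qed
qed

text \<open>The product of two approximants is \<open>u\<^sup>2 q(u) r(u)\<close> with \<open>u = 1 / (1 + p)\<close>. One factor \<open>u\<close> is absorbed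
into the polynomial, which therefore is \<open>pCons 0 (q * r)\<close>.\<close>

lemma causal_approx_mult:
  assumes F: "F \<in> causal_approx D" and G: "G \<in> causal_approx D"
  shows "(\<lambda>w. F w * G w) \<in> causal_approx D"
  unfolding causal_approx_def
proof (intro CollectI allI impI)
  fix e :: real assume e: "e > 0"
  obtain B where B: "\<And>w. w \<in> D \<Longrightarrow> norm (G w) \<le> B" "B > 0"
    using causal_approx_bounded[OF G] by blast
  define P where "P q w = poly q (1 / (1 + \<i> * of_real w)) / (1 + \<i> * of_real w)" for q w
  have "e / (2 * B) > 0" using e B(2) by simp
  then obtain q where q: "\<And>w. w \<in> D \<Longrightarrow> norm (F w - P q w) \<le> e / (2 * B)"
    using causal_approxE[OF F] unfolding P_def by blast
  obtain C where C: "\<And>w. norm (P q w) \<le> C" "C > 0"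
    using causal_poly_bounded[of q] unfolding P_def by blast
  have "e / (2 * C) > 0" using e C(2) by simp
  then obtain r where r: "\<And>w. w \<in> D \<Longrightarrow> norm (G w - P r w) \<le> e / (2 * C)"
    using causal_approxE[OF G] unfolding P_def by blast
  show "\<exists>q. \<forall>w\<in>D. norm (F w * G w - poly q (1 / (1 + \<i> * of_real w)) / (1 + \<i> * of_real w)) \<le> e"
  proof (intro exI[of _ "pCons 0 (q * r)"] ballI)
    fix w assume w: "w \<in> D"
    have "F w * G w - poly (pCons 0 (q * r)) (1 / (1 + \<i> * of_real w)) / (1 + \<i> * of_real w)
        = (F w - P q w) * G w + P q w * (G w - P r w)"
      by (simp add: P_def algebra_simps)
    also have "norm \<dots> \<le> e / (2 * B) * B + C * (e / (2 * C))"
    proof (rule norm_triangle_mono)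
      show "norm ((F w - P q w) * G w) \<le> e / (2 * B) * B"
        unfolding norm_mult by (rule mult_mono[OF q[OF w] B(1)[OF w]]) (use e B(2) in auto)
      show "norm (P q w * (G w - P r w)) \<le> C * (e / (2 * C))"
        unfolding norm_mult by (rule mult_mono[OF C(1) r[OF w]]) (use C(2) in auto)
    qed
    also have "\<dots> = e" using B(2) C(2) by simp
    finally show "norm (F w * G w - poly (pCons 0 (q * r)) (1 / (1 + \<i> * of_real w)) / (1 + \<i> * of_real w)) \<le> e" .
  qed
qed

lemma causal_approx_power:
  assumes "F \<in> causal_approx D"
  shows "(\<lambda>w. F w ^ Suc n) \<in> causal_approx D"
  by (induction n) (use assms causal_approx_mult[OF assms] in auto)

lemma causal_approx_sum:
  fixes F :: "nat \<Rightarrow> real \<Rightarrow> complex"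
  assumes "\<And>n. F n \<in> causal_approx D"
  shows "(\<lambda>w. \<Sum>n<N. F n w) \<in> causal_approx D"
proof (induction N)
  case 0
  show ?case using causal_approx_poly[of 0] by simp
next
  case (Suc N)
  then show ?case using causal_approx_add[OF Suc assms[of N]] by simp
qed

text \<open>One step of pole pushing, by the expansion of \<open>1 / (p - b')\<close> into powers of \<open>1 / (p - b)\<close>. The
geometric series converges uniformly even on an unbounded \<open>D\<close>, because its ratio is at most
\<open>\<bar>b' - b\<bar> / r\<close> everywhere. Therefore the high frequencies are covered as well.\<close>

lemma causal_approx_push_pole:
  assumes b: "(\<lambda>w. 1 / (\<i> * of_real w - b)) \<in> causal_approx D"
    and r: "\<And>w. w \<in> D \<Longrightarrow> r \<le> norm (\<i> * of_real w - b)" and b': "norm (b' - b) < r"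
  shows "(\<lambda>w. 1 / (\<i> * of_real w - b')) \<in> causal_approx D"
proof (rule causal_approx_closed)
  fix e :: real assume e: "e > 0"
  define \<rho> where "\<rho> = norm (b' - b) / r"
  have r0: "r > 0" using b' norm_ge_zero[of "b' - b"] by linarith
  have \<rho>: "0 \<le> \<rho>" "\<rho> < 1" using b' r0 by (auto simp: \<rho>_def)
  have "e * (r - norm (b' - b)) > 0" using e b' by simp
  then obtain N where N: "\<rho> ^ N < e * (r - norm (b' - b))"
    using real_arch_pow_inv \<rho>(2) by blast
  define F where "F w = (\<Sum>n<N. (b' - b) ^ n * (1 / (\<i> * of_real w - b)) ^ Suc n)" for w
  have "F \<in> causal_approx D"
    unfolding F_def by (intro causal_approx_sum causal_approx_smult causal_approx_power b)
  moreover have "norm (1 / (\<i> * of_real w - b') - F w) \<le> e" if w: "w \<in> D" for w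
  proof -
    define u where "u = \<i> * of_real w - b"
    define h where "h = b' - b"
    have u: "r \<le> norm u" "u \<noteq> 0" using r[OF w] r0 by (auto simp: u_def)
    have uh: "r - norm h \<le> norm (u - h)"
      using u(1) norm_triangle_ineq2[of u h] by simp
    then have uh0: "u - h \<noteq> 0" using b' by (auto simp: h_def)
    have hu: "norm (h / u) \<le> \<rho>"
      using u r0 by (auto simp: \<rho>_def h_def norm_divide intro!: divide_left_mono mult_pos_pos)
    have "F w = (\<Sum>n<N. (h / u) ^ n) / u"
      by (simp add: F_def sum_divide_distrib power_divide mult.commute flip: u_def h_def)
    also have "(\<Sum>n<N. (h / u) ^ n) = (1 - (h / u) ^ N) / (1 - h / u)"
      using u(2) uh0 by (intro sum_gp_strict[THEN trans]) auto
    also have "\<dots> / u = (1 - (h / u) ^ N) / ((1 - h / u) * u)"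
      by simp
    also have "(1 - h / u) * u = u - h"
      using u(2) by (simp add: field_simps)
    finally have "1 / (u - h) - F w = (h / u) ^ N / (u - h)"
      by (simp add: diff_divide_distrib)
    also have "norm \<dots> \<le> \<rho> ^ N / (r - norm h)"
      unfolding norm_divide norm_power using hu uh b'
      using \<rho>(1) by (intro frac_le power_mono zero_le_power) (auto simp: h_def norm_divide)
    also have "\<dots> \<le> e"
      using N b' by (simp add: divide_le_eq h_def)
    finally show ?thesis by (simp add: u_def h_def)
  qed
  ultimately show "\<exists>F\<in>causal_approx D. \<forall>w\<in>D. norm (1 / (\<i> * of_real w - b') - F w) \<le> e"
    by blast
qed

text \<open>The points \<open>b\<close> for which \<open>1 / (p - b)\<close> is approximable form a relatively open and closed subset of
any connected set avoiding the frequencies. The broken line from \<open>- 1\<close> over \<open>\<i> * \<Omega>\<close> to \<open>a\<close> is such a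
set, since it meets the imaginary axis in the gap only.\<close>

lemma causal_approx_pole:
  assumes D: "closed D" and \<Omega>: "\<Omega> \<notin> D" and a: "Re a > 0"
  shows "(\<lambda>w. 1 / (\<i> * of_real w - a)) \<in> causal_approx D"
proof -
  define L where "L = (\<lambda>w. \<i> * complex_of_real w) ` D"
  define S where "S = closed_segment (-1) (\<i> * of_real \<Omega>) \<union> closed_segment (\<i> * of_real \<Omega>) a"
  define P where "P b \<longleftrightarrow> (\<lambda>w. 1 / (\<i> * of_real w - b)) \<in> causal_approx D" for b
  have "closed L"
  proof -
    have "L = {p. Re p = 0} \<inter> Im -` D"
      by (auto simp: L_def image_iff complex_eq_iff)
    moreover have "closed {p. Re p = 0}" by (intro closed_Collect_eq continuous_intros)
    moreover have "closed (Im -` D)" by (intro continuous_closed_vimage D) (auto intro: continuous_intros)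
    ultimately show ?thesis by auto
  qed
  have disj: "b \<notin> L" if "b \<in> S" for b
  proof
    assume "b \<in> L"
    then have b: "Re b = 0" "Im b \<in> D" by (auto simp: L_def)
    from that have "b = \<i> * of_real \<Omega>"
      unfolding S_def closed_segment_def using b(1) a by (auto simp: complex_eq_iff scaleR_conv_of_real)
    then show False using b \<Omega> by simp
  qed
  have "connected S"
    unfolding S_def by (intro connected_Un connected_segment) auto
  have "P (- 1) = P a"
  proof (rule connected_equivalence_relation[OF \<open>connected S\<close>, where R = "\<lambda>x y. P x = P y"])
    fix b assume "b \<in> S"
    then have "b \<notin> L" by (rule disj)
    then obtain e where e: "e > 0" "ball b e \<subseteq> - L"
      using \<open>closed L\<close> open_contains_ball[of "- L"] by (auto simp: open_closed)
    have far: "e \<le> norm (\<i> * of_real w - b)" if "w \<in> D" for w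
      using e(2) that by (force simp: L_def dist_norm norm_minus_commute)
    \<comment> \<open>within a third of the distance, each of the two points can be pushed to the other\<close>
    have "P b = P x" if x: "x \<in> S \<inter> ball b (e / 3)" for x
    proof
      have bx: "norm (x - b) < e / 3" "norm (b - x) < e / 3" using x by (auto simp: dist_norm norm_minus_commute)
      show "P x" if "P b"
        using causal_approx_push_pole[OF that[unfolded P_def] far] bx e(1) by (simp add: P_def)
      have "e * 2 / 3 \<le> norm (\<i> * of_real w - x)" if "w \<in> D" for w
        using far[OF that] bx norm_triangle_ineq2[of "\<i> * of_real w - b" "x - b"] by simp
      then show "P b" if "P x"
        using causal_approx_push_pole[OF that[unfolded P_def], of "e * 2 / 3" b] bx e(1) by (simp add: P_def)
    qed
    then show "\<exists>T. openin (top_of_set S) T \<and> b \<in> T \<and> (\<forall>x\<in>T. P b = P x)"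
      using \<open>b \<in> S\<close> e(1) by (intro exI[of _ "S \<inter> ball b (e / 3)"]) auto
  qed (auto simp: S_def)
  moreover have "P (- 1)"
    using causal_approx_poly[of 1 D] by (simp add: P_def add.commute)
  ultimately show ?thesis by (simp add: P_def)
qed

section \<open>Superpositions of oscillations\<close>

lemma sigma_finite_lebesgue: "sigma_finite_measure (lebesgue :: real measure)"
proof -
  obtain A :: "real set set" where A: "countable A" "A \<subseteq> sets lborel" "\<Union>A = space lborel"
      "\<forall>a\<in>A. emeasure lborel a \<noteq> \<infinity>"
    using lborel.sigma_finite_countable by blast
  show ?thesis
  proof (rule sigma_finite_measure.intro, intro exI conjI)
    show "countable A" by (fact A)
    show "A \<subseteq> sets lebesgue" using A(2) by (auto intro: sets_completionI_sets)
    show "\<Union>A = space lebesgue" using A(3) by simp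
    show "\<forall>a\<in>A. emeasure lebesgue a \<noteq> \<infinity>" using A(2,4) by (auto simp: subset_eq)
  qed
qed

lemma borel_measurable_lebesgueI:
  "f \<in> borel_measurable (borel :: real measure) \<Longrightarrow> f \<in> borel_measurable lebesgue"
  by (intro measurable_completion) simp

text \<open>The measure \<open>N\<close> will be the counting measure for the discrete spectrum, with the frequencies
\<open>\<theta>\<close>, and Lebesgue measure for the spectral density. The measurability of \<open>H\<close> is required in the
frequency itself, which makes the lemma applicable to both.\<close>

lemma Fubini_kernel:
  fixes H :: "'s \<Rightarrow> real \<Rightarrow> complex" and C :: "'n \<Rightarrow> complex"
  assumes M: "sigma_finite_measure M" and N: "sigma_finite_measure N"
    and C: "integrable N C" and \<theta>: "\<theta> \<in> N \<rightarrow>\<^sub>M borel"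
    and H: "(\<lambda>(s, w). H s w) \<in> borel_measurable (M \<Otimes>\<^sub>M borel)"
    and bd: "\<And>w. (\<integral>\<^sup>+s. ennreal (norm (H s w)) \<partial>M) \<le> ennreal B"
  shows "integrable M (\<lambda>s. LINT n|N. H s (\<theta> n) * C n)"
    and "(LINT s|M. LINT n|N. H s (\<theta> n) * C n) = (LINT n|N. (LINT s|M. H s (\<theta> n)) * C n)"
proof -
  interpret M: sigma_finite_measure M by fact
  interpret N: sigma_finite_measure N by fact
  interpret P: pair_sigma_finite M N ..
  note [measurable] = \<theta> borel_measurable_integrable[OF C]
  have [measurable]: "(\<lambda>(s, n). H s (\<theta> n)) \<in> borel_measurable (M \<Otimes>\<^sub>M N)"
    using measurable_compose[OF _ H, of "\<lambda>(s, n). (s, \<theta> n)" "M \<Otimes>\<^sub>M N"]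
    by (simp add: case_prod_unfold)
  have m: "(\<lambda>(s, n). H s (\<theta> n) * C n) \<in> borel_measurable (M \<Otimes>\<^sub>M N)"
    by measurable
  have "(\<integral>\<^sup>+ p. ennreal (norm (case p of (s, n) \<Rightarrow> H s (\<theta> n) * C n)) \<partial>(M \<Otimes>\<^sub>M N))
      = (\<integral>\<^sup>+ n. \<integral>\<^sup>+ s. ennreal (norm (H s (\<theta> n))) * ennreal (norm (C n)) \<partial>M \<partial>N)"
    by (subst P.nn_integral_snd[symmetric]) (auto simp: norm_mult ennreal_mult)
  also have "\<dots> = (\<integral>\<^sup>+ n. (\<integral>\<^sup>+ s. ennreal (norm (H s (\<theta> n))) \<partial>M) * ennreal (norm (C n)) \<partial>N)"
    by (intro nn_integral_cong nn_integral_multc) measurable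
  also have "\<dots> \<le> (\<integral>\<^sup>+ n. ennreal B * ennreal (norm (C n)) \<partial>N)"
    by (intro nn_integral_mono mult_right_mono bd) auto
  also have "\<dots> = ennreal B * (\<integral>\<^sup>+ n. ennreal (norm (C n)) \<partial>N)"
    by (intro nn_integral_cmult) measurable
  also have "\<dots> < \<infinity>"
    using C by (auto simp: integrable_iff_bounded ennreal_mult_less_top)
  finally have i: "integrable (M \<Otimes>\<^sub>M N) (\<lambda>(s, n). H s (\<theta> n) * C n)"
    using m by (auto intro: integrableI_bounded)
  show "integrable M (\<lambda>s. LINT n|N. H s (\<theta> n) * C n)"
    using P.integrable_fst'[OF i] by simp
  show "(LINT s|M. LINT n|N. H s (\<theta> n) * C n) = (LINT n|N. (LINT s|M. H s (\<theta> n)) * C n)"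
    using P.Fubini_integral[OF i] by simp
qed

text \<open>The complex measure with point masses \<open>c k\<close> at \<open>\<omega> k\<close> and density \<open>Xc\<close>. It enters the proofs through
its integrals against bounded functions only, here called pairings.\<close>

locale spectral_data =
  fixes \<omega> :: "nat \<Rightarrow> real" and c :: "nat \<Rightarrow> complex" and Xc :: "real \<Rightarrow> complex"
  assumes summable_c: "summable (\<lambda>k. norm (c k))"
    and integrable_Xc: "integrable lebesgue Xc"
begin

definition pairing :: "(real \<Rightarrow> complex) \<Rightarrow> complex" where
  "pairing f = (\<Sum>k. c k * f (\<omega> k)) + (LINT w|lebesgue. f w * Xc w)"

lemma integrable_c: "integrable (count_space UNIV) c"
  using summable_c by (simp add: integrable_count_space_nat_iff)

lemma measurable_Xc [measurable]: "Xc \<in> borel_measurable lebesgue"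
  using integrable_Xc by auto

lemma
  assumes bd: "\<And>w. norm (f w) \<le> B"
  shows summable_bounded: "summable (\<lambda>k. norm (f (\<omega> k) * c k))"
    and suminf_eq_integral: "(\<Sum>k. c k * f (\<omega> k)) = (LINT k|count_space UNIV. f (\<omega> k) * c k)"
proof -
  show s: "summable (\<lambda>k. norm (f (\<omega> k) * c k))"
    by (rule summable_comparison_test'[OF summable_mult[OF summable_c, of B], of 0])
       (use bd in \<open>auto simp: norm_mult intro!: mult_right_mono\<close>)
  then have "integrable (count_space UNIV) (\<lambda>k. f (\<omega> k) * c k)"
    by (simp add: integrable_count_space_nat_iff)
  then show "(\<Sum>k. c k * f (\<omega> k)) = (LINT k|count_space UNIV. f (\<omega> k) * c k)"
    by (simp add: integral_count_space_nat mult.commute)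
qed

lemma pairing_eq_integrals:
  assumes "\<And>w. norm (f w) \<le> B"
  shows "pairing f = (LINT k|count_space UNIV. f (\<omega> k) * c k) + (LINT w|lebesgue. f w * Xc w)"
  using suminf_eq_integral[OF assms] by (simp add: pairing_def)

lemma pairing_exchange:
  fixes H :: "'s \<Rightarrow> real \<Rightarrow> complex"
  assumes M: "sigma_finite_measure M"
    and H: "(\<lambda>(s, w). H s w) \<in> borel_measurable (M \<Otimes>\<^sub>M borel)"
    and bd: "\<And>w. (\<integral>\<^sup>+s. ennreal (norm (H s w)) \<partial>M) \<le> ennreal B"
    and bd': "\<And>s w. norm (H s w) \<le> B' s"
  shows "pairing (\<lambda>w. LINT s|M. H s w) = (LINT s|M. pairing (H s))"
proof -
  have eq: "pairing (H s) = (LINT k|count_space UNIV. H s (\<omega> k) * c k) + (LINT w|lebesgue. H s w * Xc w)" for s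
    using bd' by (rule pairing_eq_integrals)
  have "norm (LINT s|M. H s w) \<le> max B 0" for w
  proof (cases "integrable M (\<lambda>s. H s w)")
    case True
    then have "ennreal (norm (LINT s|M. H s w)) \<le> (\<integral>\<^sup>+s. ennreal (norm (H s w)) \<partial>M)"
      by (rule integral_norm_bound_ennreal)
    also note bd
    finally show ?thesis
      by (cases "B \<ge> 0") (auto simp: ennreal_neg)
  qed (simp add: not_integrable_integral_eq)
  then have "pairing (\<lambda>w. LINT s|M. H s w) = (LINT k|count_space UNIV. (LINT s|M. H s (\<omega> k)) * c k)
      + (LINT w|lebesgue. (LINT s|M. H s w) * Xc w)"
    by (rule pairing_eq_integrals)
  moreover note F1 = Fubini_kernel[OF M sigma_finite_measure_count_space integrable_c _ H bd, of \<omega>]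
    and F2 = Fubini_kernel[OF M sigma_finite_lebesgue integrable_Xc _ H bd, of "\<lambda>w. w"]
  ultimately show "pairing (\<lambda>w. LINT s|M. H s w) = (LINT s|M. pairing (H s))"
    unfolding eq by (subst Bochner_Integration.integral_add) (auto simp: measurable_completion)
qed

lemma pairing_measurable:
  fixes H :: "'s \<Rightarrow> real \<Rightarrow> complex"
  assumes H [measurable]: "(\<lambda>(s, w). H s w) \<in> borel_measurable (M \<Otimes>\<^sub>M borel)"
    and bd': "\<And>s w. norm (H s w) \<le> B' s"
  shows "(\<lambda>s. pairing (H s)) \<in> borel_measurable M"
proof -
  interpret L: sigma_finite_measure "lebesgue :: real measure" by (rule sigma_finite_lebesgue)
  interpret C: sigma_finite_measure "count_space (UNIV :: nat set)"
    by (rule sigma_finite_measure_count_space)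
  have eq: "pairing (H s) = (LINT k|count_space UNIV. H s (\<omega> k) * c k) + (LINT w|lebesgue. H s w * Xc w)" for s
    using bd' by (rule pairing_eq_integrals)
  have [measurable]: "(\<lambda>w. w) \<in> lebesgue \<rightarrow>\<^sub>M (borel :: real measure)"
    by (simp add: measurable_completion)
  have [measurable]: "(\<lambda>(s, w). H s w) \<in> borel_measurable (M \<Otimes>\<^sub>M lebesgue)"
    using measurable_compose[OF _ H, of "\<lambda>(s, w). (s, w)" "M \<Otimes>\<^sub>M lebesgue"]
    by (simp add: case_prod_unfold)
  have [measurable]: "(\<lambda>(s, n). H s (\<omega> n)) \<in> borel_measurable (M \<Otimes>\<^sub>M count_space UNIV)"
    using measurable_compose[OF _ H, of "\<lambda>(s, n). (s, \<omega> n)" "M \<Otimes>\<^sub>M count_space UNIV"]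
    by (simp add: case_prod_unfold)
  show ?thesis
    unfolding eq by measurable
qed

lemma pairing_tendsto:
  assumes meas: "\<And>i. f i \<in> borel_measurable lebesgue"
    and bd: "\<And>i w. norm (f i w) \<le> B"
    and lim: "\<And>w. (\<lambda>i. f i w) \<longlonglongrightarrow> g w"
  shows "(\<lambda>i. pairing (f i)) \<longlonglongrightarrow> pairing g"
proof -
  have bg: "norm (g w) \<le> B" for w
    by (rule LIMSEQ_le_const2[OF tendsto_norm[OF lim]]) (use bd in auto)
  have mg: "g \<in> borel_measurable lebesgue"
    by (rule borel_measurable_LIMSEQ_metric[OF meas lim])
  have "(\<lambda>i. LINT k|count_space UNIV. f i (\<omega> k) * c k) \<longlonglongrightarrow> (LINT k|count_space UNIV. g (\<omega> k) * c k)"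
    by (rule integral_dominated_convergence[where w = "\<lambda>k. B * norm (c k)"])
       (use bd lim integrable_c in \<open>auto simp: norm_mult intro!: mult_right_mono tendsto_intros\<close>)
  moreover have "(\<lambda>i. LINT w|lebesgue. f i w * Xc w) \<longlonglongrightarrow> (LINT w|lebesgue. g w * Xc w)"
    by (rule integral_dominated_convergence[where w = "\<lambda>w. B * norm (Xc w)"])
       (use bd lim integrable_Xc meas mg in \<open>auto simp: norm_mult intro!: mult_right_mono tendsto_intros\<close>)
  ultimately show ?thesis
    unfolding pairing_eq_integrals[of "f _", OF bd] pairing_eq_integrals[of g, OF bg]
    by (rule tendsto_add)
qed

lemma pairing_cmult:
  assumes "\<And>w. norm (f w) \<le> B"
  shows "pairing (\<lambda>w. a * f w) = a * pairing f"
proof -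
  have "summable (\<lambda>k. c k * f (\<omega> k))"
    using summable_norm_cancel[OF summable_bounded[OF assms]] by (simp add: mult.commute)
  then have "(\<Sum>k. a * (c k * f (\<omega> k))) = a * (\<Sum>k. c k * f (\<omega> k))"
    by (rule suminf_mult)
  then show ?thesis
    by (simp add: pairing_def algebra_simps)
qed

lemma pairing_norm_le:
  assumes bd: "\<And>w. norm (f w) \<le> B" and [measurable]: "f \<in> borel_measurable lebesgue"
  shows "norm (pairing f) \<le> B * ((\<Sum>k. norm (c k)) + (LINT w|lebesgue. norm (Xc w)))"
proof -
  have sc: "summable (\<lambda>k. norm (c k * f (\<omega> k)))"
    using summable_bounded[OF bd] by (simp add: mult.commute)
  have "norm (\<Sum>k. c k * f (\<omega> k)) \<le> (\<Sum>k. norm (c k * f (\<omega> k)))"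
    using sc by (rule summable_norm)
  also have "\<dots> \<le> (\<Sum>k. norm (c k) * B)"
    by (rule suminf_le[OF _ sc summable_mult2[OF summable_c]]) (simp add: norm_mult bd mult_left_mono)
  also have "\<dots> = B * (\<Sum>k. norm (c k))"
    using suminf_mult2[OF summable_c, of B] by (simp add: mult.commute)
  finally have 1: "norm (\<Sum>k. c k * f (\<omega> k)) \<le> B * (\<Sum>k. norm (c k))" .
  have "norm (LINT w|lebesgue. f w * Xc w) \<le> (LINT w|lebesgue. B * norm (Xc w))"
  proof (rule Bochner_Integration.integral_norm_bound_integral)
    show B: "integrable lebesgue (\<lambda>w. B * norm (Xc w))" using integrable_Xc by simp
    have le: "norm (f w * Xc w) \<le> B * norm (Xc w)" for w
      by (simp add: norm_mult bd mult_right_mono)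
    then show "norm (f w * Xc w) \<le> B * norm (Xc w)" for w .
    show "integrable lebesgue (\<lambda>w. f w * Xc w)"
    proof (rule Bochner_Integration.integrable_bound[OF B])
      show "(\<lambda>w. f w * Xc w) \<in> borel_measurable lebesgue" by measurable
      show "AE w in lebesgue. norm (f w * Xc w) \<le> norm (B * norm (Xc w))"
        unfolding real_norm_def by (intro AE_I2 order_trans[OF le abs_ge_self])
    qed
  qed
  then have 2: "norm (LINT w|lebesgue. f w * Xc w) \<le> B * (LINT w|lebesgue. norm (Xc w))"
    by simp
  show ?thesis
    unfolding pairing_def distrib_left using 1 2 by (rule norm_triangle_mono)
qed

end

section \<open>Uniqueness of the spectrum\<close>

lemma norm_exp_ii [simp]: "norm (exp (\<i> * complex_of_real x)) = 1" "norm (exp (- (\<i> * complex_of_real x))) = 1"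
  by (simp_all add: norm_exp_eq_Re)

lemma char_gaussian:
  "(LINT t|lborel. of_real (std_normal_density t) * exp (\<i> * of_real (u * t)))
     = complex_of_real (sqrt (2 * pi) * std_normal_density u)"
proof -
  have "complex_of_real (exp (- u\<^sup>2 / 2)) = char std_normal_distribution u"
    by (simp add: char_std_normal_distribution)
  also have "\<dots> = (LINT t|lborel. of_real (std_normal_density t) * exp (\<i> * of_real (u * t)))"
    unfolding char_def by (subst integral_density) (auto simp: scaleR_conv_of_real)
  finally show ?thesis
    by (simp add: std_normal_density_def)
qed

lemma nn_integral_std_normal: "(\<integral>\<^sup>+t. ennreal (std_normal_density t) \<partial>lborel) = 1"
  by (simp add: nn_integral_eq_integral integral_std_normal_moment_even[of 0, simplified] integrable_std_normal_moment[of 0, simplified])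

lemma std_normal_le_1: "std_normal_density x \<le> 1"
proof -
  have "1 \<le> sqrt (2 * pi)" using pi_gt3 by simp
  moreover have "exp (- x\<^sup>2 / 2) \<le> 1" by simp
  ultimately have "exp (- x\<^sup>2 / 2) / sqrt (2 * pi) \<le> 1 / 1" by (intro frac_le) auto
  then show ?thesis by (simp add: std_normal_density_def)
qed

context spectral_data begin

text \<open>A Gaussian is a superposition of oscillations, so its pairing is determined by the pairings with
oscillations.\<close>

lemma pairing_gaussian:
  "pairing (\<lambda>w. of_real (std_normal_density (m * (w - s)))) =
     (LINT t|lborel. of_real (std_normal_density t / sqrt (2 * pi)) * exp (- \<i> * of_real (m * s * t))
        * pairing (\<lambda>w. exp (\<i> * of_real (w * (m * t)))))"
proof -
  define H where "H t w = of_real (std_normal_density t / sqrt (2 * pi)) * exp (- \<i> * of_real (m * s * t))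
        * exp (\<i> * of_real (w * (m * t)))" for t w
  have norm_H: "norm (H t w) = std_normal_density t / sqrt (2 * pi)" for t w
    by (simp add: H_def norm_mult norm_divide normal_density_nonneg norm_exp_eq_Re)
  have le: "norm (H t w) \<le> std_normal_density t" for t w
  proof -
    have "1 \<le> sqrt (2 * pi)" using pi_gt3 by simp
    then have "std_normal_density t / sqrt (2 * pi) \<le> std_normal_density t / 1"
      by (intro divide_left_mono) (auto simp: normal_density_nonneg)
    then show ?thesis unfolding norm_H by simp
  qed
  have "H t w = of_real (1 / sqrt (2 * pi)) * (of_real (std_normal_density t) * exp (\<i> * of_real ((m * (w - s)) * t)))" for t w
    by (simp add: H_def mult.assoc flip: exp_add) (simp add: algebra_simps)
  then have "(LINT t|lborel. H t w) = of_real (1 / sqrt (2 * pi)) * (LINT t|lborel. of_real (std_normal_density t) * exp (\<i> * of_real ((m * (w - s)) * t)))" for w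
    by simp
  then have "(LINT t|lborel. H t w) = of_real (std_normal_density (m * (w - s)))" for w
    unfolding char_gaussian by simp
  then have "pairing (\<lambda>w. of_real (std_normal_density (m * (w - s)))) = pairing (\<lambda>w. LINT t|lborel. H t w)"
    by simp
  also have "\<dots> = (LINT t|lborel. pairing (H t))"
  proof (rule pairing_exchange[OF sigma_finite_lborel])
    show "(\<lambda>(t, w). H t w) \<in> borel_measurable (lborel \<Otimes>\<^sub>M borel)"
      unfolding H_def by measurable
    show "(\<integral>\<^sup>+t. ennreal (norm (H t w)) \<partial>lborel) \<le> ennreal 1" for w
      unfolding ennreal_1 nn_integral_std_normal[symmetric] by (intro nn_integral_mono ennreal_leI le)
  qed (rule le)
  also have "\<dots> = (LINT t|lborel. of_real (std_normal_density t / sqrt (2 * pi)) * exp (- \<i> * of_real (m * s * t))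
        * pairing (\<lambda>w. exp (\<i> * of_real (w * (m * t)))))"
    unfolding H_def by (intro Bochner_Integration.integral_cong refl pairing_cmult[where B = 1]) simp
  finally show ?thesis .
qed

text \<open>The convolution of a bounded function with a Gaussian is a superposition of shifted Gaussians.
Together with \<open>pairing_gaussian\<close> this expresses its pairing through pairings with oscillations.\<close>

lemma pairing_mollified:
  assumes [measurable]: "f \<in> borel_measurable borel" and bd: "\<And>w. norm (f w) \<le> B" and m: "0 < m"
  shows "pairing (\<lambda>w. LINT s|lborel. f s * of_real (m * std_normal_density (m * (w - s)))) =
    (LINT s|lborel. f s * of_real m * pairing (\<lambda>w. of_real (std_normal_density (m * (w - s)))))"
proof -
  define H where "H s w = (f s * of_real m) * of_real (std_normal_density (m * (w - s)))" for s w
  have B: "0 \<le> B" using bd[of 0] norm_ge_zero order_trans by blast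
  have "pairing (\<lambda>w. LINT s|lborel. H s w) = (LINT s|lborel. pairing (H s))"
  proof (rule pairing_exchange[OF sigma_finite_lborel])
    show "(\<lambda>(s, w). H s w) \<in> borel_measurable (lborel \<Otimes>\<^sub>M borel)"
      unfolding H_def by measurable
    show "norm (H s w) \<le> B * m" for s w
      unfolding H_def norm_mult using bd[of s] m B std_normal_le_1[of "m * (w - s)"]
      by (auto simp: normal_density_nonneg intro!: mult_mono mult_left_le mult_nonneg_nonneg order_trans[OF mult_left_le])
    show "(\<integral>\<^sup>+s. ennreal (norm (H s w)) \<partial>lborel) \<le> ennreal B" for w
    proof -
      have "(\<integral>\<^sup>+s. ennreal (norm (H s w)) \<partial>lborel) \<le> (\<integral>\<^sup>+s. ennreal (B * (m * std_normal_density (m * (w - s)))) \<partial>lborel)"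
        by (intro nn_integral_mono ennreal_leI)
           (use bd m in \<open>auto simp: H_def norm_mult normal_density_nonneg mult.assoc intro!: mult_right_mono\<close>)
      also have "\<dots> = ennreal B * (\<integral>\<^sup>+s. ennreal (m * std_normal_density (m * (w - s))) \<partial>lborel)"
        using B m by (subst nn_integral_cmult[symmetric]) (auto simp: ennreal_mult normal_density_nonneg)
      also have "(\<integral>\<^sup>+s. ennreal (m * std_normal_density (m * (w - s))) \<partial>lborel)
          = ennreal \<bar>- 1 / m\<bar> * (\<integral>\<^sup>+z. ennreal (m * std_normal_density z) \<partial>lborel)"
        using m by (subst nn_integral_real_affine[where c = "- 1 / m" and t = w]) auto
      also have "\<dots> = ennreal \<bar>- 1 / m\<bar> * (ennreal m * 1)"
        using m by (subst nn_integral_std_normal[symmetric], subst nn_integral_cmult[symmetric])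
          (auto simp: ennreal_mult normal_density_nonneg)
      also have "\<dots> = 1"
        using m by (simp flip: ennreal_mult)
      finally show ?thesis by simp
    qed
  qed
  also have "\<dots> = (LINT s|lborel. f s * of_real m * pairing (\<lambda>w. of_real (std_normal_density (m * (w - s)))))"
    unfolding H_def by (intro Bochner_Integration.integral_cong refl pairing_cmult[where B = 1])
      (auto simp: normal_density_nonneg std_normal_le_1)
  finally show ?thesis
    by (simp add: H_def mult.assoc)
qed

end

lemma mollified_eq:
  assumes m: "0 < m"
  shows "(LINT s|lborel. f s * complex_of_real (m * std_normal_density (m * (w - s)))) =
    (LINT z|lborel. f (w - z / m) * of_real (std_normal_density z))"
proof -
  have "\<bar>- 1 / m\<bar> *\<^sub>R (f (w + - 1 / m * z) * complex_of_real (m * std_normal_density (m * (w - (w + - 1 / m * z)))))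
      = f (w - z / m) * of_real (std_normal_density z)" for z
    using m by (simp add: scaleR_conv_of_real)
  then show ?thesis
    using m by (subst lborel_integral_real_affine[where c = "- 1 / m" and t = w])
      (simp_all only: integral_scaleR_right[symmetric], simp)
qed

lemma norm_mollified_le:
  assumes "0 < m" and [measurable]: "f \<in> borel_measurable borel" and bd: "\<And>w. norm (f w) \<le> B"
  shows "norm (LINT s|lborel. f s * complex_of_real (m * std_normal_density (m * (w - s)))) \<le> B"
proof -
  have "norm (LINT z|lborel. f (w - z / m) * of_real (std_normal_density z)) \<le> (LINT z|lborel. B * std_normal_density z)"
    by (rule Bochner_Integration.integral_norm_bound_integral, rule Bochner_Integration.integrable_bound[of _ "\<lambda>z. B * std_normal_density z"])
       (use bd in \<open>auto simp: norm_mult normal_density_nonneg integrable_std_normal_moment[of 0, simplified] abs_mult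
          intro!: mult_right_mono order_trans[OF bd abs_ge_self]\<close>)
  then show ?thesis
    unfolding mollified_eq[OF assms(1)] by (simp add: integral_std_normal_moment_even[of 0, simplified])
qed

lemma mollified_tendsto:
  assumes cont: "continuous_on UNIV f" and bd: "\<And>w. norm (f w) \<le> B"
  shows "(\<lambda>i. LINT s|lborel. f s * complex_of_real (real (Suc i) * std_normal_density (real (Suc i) * (w - s)))) \<longlonglongrightarrow> f w"
proof -
  have [measurable]: "f \<in> borel_measurable borel"
    using cont by (rule borel_measurable_continuous_onI)
  have "(\<lambda>i. LINT z|lborel. f (w - z / real (Suc i)) * of_real (std_normal_density z))
      \<longlonglongrightarrow> (LINT z|lborel. f w * of_real (std_normal_density z))"
  proof (rule integral_dominated_convergence[where w = "\<lambda>z. B * std_normal_density z"])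
    show "AE z in lborel. (\<lambda>i. f (w - z / real (Suc i)) * of_real (std_normal_density z)) \<longlonglongrightarrow> f w * of_real (std_normal_density z)"
    proof (rule AE_I2, rule tendsto_mult[OF _ tendsto_const])
      fix z
      have "(\<lambda>i. z / real (Suc i)) \<longlonglongrightarrow> 0"
        by real_asymp
      then have "(\<lambda>i. w - z / real (Suc i)) \<longlonglongrightarrow> w - 0"
        by (intro tendsto_intros)
      then show "(\<lambda>i. f (w - z / real (Suc i))) \<longlonglongrightarrow> f w"
        using continuous_on_tendsto_compose[OF cont] by simp
    qed
    show "AE z in lborel. norm (f (w - z / real (Suc i)) * of_real (std_normal_density z)) \<le> B * std_normal_density z" for i
      using bd by (auto simp: norm_mult normal_density_nonneg intro!: mult_right_mono)
  qed (auto simp: integrable_std_normal_moment[of 0, simplified])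
  moreover have "(LINT z|lborel. f w * of_real (std_normal_density z)) = f w"
    using integral_std_normal_moment_even[of 0, simplified] by simp
  ultimately show ?thesis
    by (subst mollified_eq) auto
qed

text \<open>The mollified functions are uniformly bounded and converge pointwise to the given one, so
dominated convergence carries the equality of the pairings over to the limit.\<close>

lemma pairing_unique:
  assumes "spectral_data c Xc" and "spectral_data c' Xc'"
    and eq: "\<And>t. spectral_data.pairing \<omega> c Xc (\<lambda>w. exp (\<i> * of_real (w * t)))
               = spectral_data.pairing \<omega>' c' Xc' (\<lambda>w. exp (\<i> * of_real (w * t)))"
    and cont: "continuous_on UNIV f" and bd: "\<And>w. norm (f w) \<le> B"
  shows "spectral_data.pairing \<omega> c Xc f = spectral_data.pairing \<omega>' c' Xc' f"
proof -
  interpret X: spectral_data \<omega> c Xc by fact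
  interpret Y: spectral_data \<omega>' c' Xc' by fact
  have f[measurable]: "f \<in> borel_measurable borel"
    using cont by (rule borel_measurable_continuous_onI)
  define F where "F i w = (LINT s|lborel. f s * of_real (real (Suc i) * std_normal_density (real (Suc i) * (w - s))))" for i w
  have F_meas: "F i \<in> borel_measurable lebesgue" for i
    unfolding F_def by (rule borel_measurable_lebesgueI) measurable
  have F_le: "norm (F i w) \<le> B" for i w
    unfolding F_def by (rule norm_mollified_le[OF _ f bd]) simp
  have F_lim: "(\<lambda>i. F i w) \<longlonglongrightarrow> f w" for w
    unfolding F_def by (rule mollified_tendsto[OF cont bd])
  have "X.pairing (F i) = Y.pairing (F i)" for i
    unfolding F_def X.pairing_mollified[OF f bd of_nat_0_less_iff[THEN iffD2, OF zero_less_Suc]]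
      Y.pairing_mollified[OF f bd of_nat_0_less_iff[THEN iffD2, OF zero_less_Suc]]
      X.pairing_gaussian Y.pairing_gaussian eq ..
  moreover have "(\<lambda>i. X.pairing (F i)) \<longlonglongrightarrow> X.pairing f"
    by (rule X.pairing_tendsto[OF F_meas F_le F_lim])
  moreover have "(\<lambda>i. Y.pairing (F i)) \<longlonglongrightarrow> Y.pairing f"
    by (rule Y.pairing_tendsto[OF F_meas F_le F_lim])
  ultimately show ?thesis
    using LIMSEQ_unique by simp
qed

text \<open>By uniqueness, the integral of \<open>g\<close> against every bounded continuous function vanishes. A
sequence of such functions bounded by one converges almost everywhere to the conjugate sign of \<open>g\<close>,
and in the limit the integral of \<open>\<bar>g\<bar>\<close> vanishes.\<close>

lemma AE_zero_of_fourier_zero: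
  fixes g :: "real \<Rightarrow> complex"
  assumes g: "integrable lebesgue g"
    and zero: "\<And>s. (LINT t|lebesgue. exp (- \<i> * of_real (s * t)) * g t) = 0"
  shows "AE t in lebesgue. g t = 0"
proof -
  interpret X: spectral_data "\<lambda>_. 0" "\<lambda>_. 0" g
    using g by unfold_locales auto
  interpret Y: spectral_data "\<lambda>_. 0" "\<lambda>_. 0" "\<lambda>_. 0"
    by unfold_locales auto
  have "X.pairing (\<lambda>w. exp (\<i> * of_real (w * t))) = Y.pairing (\<lambda>w. exp (\<i> * of_real (w * t)))" for t
    using zero[of "- t"] by (simp add: X.pairing_def Y.pairing_def mult.commute)
  note X_Y = pairing_unique[OF X.spectral_data_axioms Y.spectral_data_axioms this, of _ 1]
  have zero': "(LINT t|lebesgue. f t * g t) = 0" if "continuous_on UNIV f" "\<And>t. norm (f t) \<le> 1" for f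
    using X_Y[OF that] by (simp add: X.pairing_def Y.pairing_def)
  have g_meas [measurable]: "g \<in> borel_measurable lebesgue" using g by auto
  define h where "h t = cnj (g t) / of_real (norm (g t))" for t
  have h_meas: "h \<in> borel_measurable lebesgue"
    unfolding h_def using measurable_compose[OF g_meas borel_measurable_continuous_onI[OF continuous_on_cnj[OF continuous_on_id]]]
    by measurable
  have norm_h: "norm (h t) \<le> 1" for t by (simp add: h_def norm_divide divide_le_eq)
  obtain N f where N: "negligible N" and f: "\<And>n::nat. continuous_on UNIV (f n)"
    and lim: "\<And>t. t \<notin> N \<Longrightarrow> (\<lambda>n. f n t) \<longlonglongrightarrow> h t"
    using lebesgue_measurable_imp_measurable_on[OF h_meas, of UNIV] unfolding measurable_on_def by auto
  \<comment> \<open>truncation to norm at most one, which does not affect the limit\<close>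
  define f' where "f' n t = f n t / of_real (max 1 (norm (f n t)))" for n t
  have f'_cont: "continuous_on UNIV (f' n)" for n
    unfolding f'_def using f by (intro continuous_intros) auto
  have f'_le: "norm (f' n t) \<le> 1" for n t
    by (simp add: f'_def norm_divide divide_le_eq)
  have f'_lim: "(\<lambda>n. f' n t) \<longlonglongrightarrow> h t" if "t \<notin> N" for t
  proof -
    have "(\<lambda>n. f' n t) \<longlonglongrightarrow> h t / of_real (max 1 (norm (h t)))"
      unfolding f'_def by (intro tendsto_intros lim that) auto
    then show ?thesis using norm_h[of t] by (simp add: max_absorb1)
  qed
  have AE_N: "AE t in lebesgue. t \<notin> N"
    using N by (simp add: negligible_iff_null_sets AE_not_in)
  have "(\<lambda>n. LINT t|lebesgue. f' n t * g t) \<longlonglongrightarrow> (LINT t|lebesgue. h t * g t)"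
  proof (rule integral_dominated_convergence[where w = "\<lambda>t. norm (g t)"])
    show "AE t in lebesgue. (\<lambda>n. f' n t * g t) \<longlonglongrightarrow> h t * g t"
      using AE_N by eventually_elim (intro tendsto_intros f'_lim)
    show "AE t in lebesgue. norm (f' n t * g t) \<le> norm (g t)" for n
      using f'_le[of n] by (auto simp: norm_mult intro!: mult_left_le_one_le)
    show "(\<lambda>t. f' n t * g t) \<in> borel_measurable lebesgue" for n
      by (intro borel_measurable_times g_meas borel_measurable_lebesgueI borel_measurable_continuous_onI f'_cont)
  qed (use g h_meas in auto)
  then have "(LINT t|lebesgue. h t * g t) = 0"
    using zero'[OF f'_cont f'_le] by (simp add: LIMSEQ_const_iff)
  moreover have "h t * g t = of_real (norm (g t))" for t
    using complex_norm_square[of "g t"] by (simp add: h_def power2_eq_square mult.commute divide_simps)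
  ultimately have "(LINT t|lebesgue. norm (g t)) = 0"
    by simp
  then show ?thesis
    using g by (subst (asm) integral_nonneg_eq_0_iff_AE) auto
qed

section \<open>Fourier transforms of anticausal kernels\<close>

lemma fourier_convolution:
  fixes f g :: "real \<Rightarrow> complex"
  assumes f: "integrable lborel f" and g: "integrable lborel g"
  shows "\<exists>h. integrable lborel h \<and> (\<forall>w. (LINT t|lborel. exp (- \<i> * of_real (w * t)) * h t)
     = (LINT t|lborel. exp (- \<i> * of_real (w * t)) * f t) * (LINT t|lborel. exp (- \<i> * of_real (w * t)) * g t))"
proof (intro exI conjI allI)
  define e where "e w t = exp (- \<i> * complex_of_real (w * t))" for w t
  have norm_e: "norm (e w t) = 1" for w t by (simp add: e_def norm_exp_eq_Re)
  have e_meas [measurable]: "(\<lambda>t. e w t) \<in> borel_measurable borel" for w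
    unfolding e_def by measurable
  note [measurable] = borel_measurable_integrable[OF f] borel_measurable_integrable[OF g]
  have g_shift: "integrable lborel (\<lambda>t. g (t - s))" for s
    using lborel_integrable_real_affine[OF g, of 1 "- s"] by simp
  have g_shift_norm: "(LINT t|lborel. norm (g (t - s))) = (LINT t|lborel. norm (g t))" for s
    using lborel_integral_real_affine[of 1 "\<lambda>t. norm (g t)" "- s"] by simp
  have fg: "integrable (lborel \<Otimes>\<^sub>M lborel) (\<lambda>(s, t). f s * g (t - s))"
  proof (rule lborel_pair.Fubini_integrable)
    show "integrable lborel (\<lambda>s. LINT t|lborel. norm (case (s, t) of (s, t) \<Rightarrow> f s * g (t - s)))"
      using f by (simp add: norm_mult g_shift_norm)
    show "AE s in lborel. integrable lborel (\<lambda>t. case (s, t) of (s, t) \<Rightarrow> f s * g (t - s))"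
      using g_shift by simp
  qed measurable
  show "integrable lborel (\<lambda>t. LINT s|lborel. f s * g (t - s))"
    using lborel_pair.integrable_snd[OF fg] by simp
  fix w
  have efg: "integrable (lborel \<Otimes>\<^sub>M lborel) (\<lambda>(s, t). e w t * (f s * g (t - s)))"
  proof (rule Bochner_Integration.integrable_bound[OF fg])
    show "(\<lambda>(s, t). e w t * (f s * g (t - s))) \<in> borel_measurable (lborel \<Otimes>\<^sub>M lborel)"
      by measurable
  qed (auto simp: norm_mult norm_e)
  have "(LINT t|lborel. e w t * (LINT s|lborel. f s * g (t - s))) = (LINT t|lborel. LINT s|lborel. e w t * (f s * g (t - s)))"
    by simp
  also have "\<dots> = (LINT s|lborel. LINT t|lborel. e w t * (f s * g (t - s)))"
    by (rule lborel_pair.Fubini_integral[OF efg])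
  also have "\<dots> = (LINT s|lborel. e w s * f s * (LINT t|lborel. e w t * g t))"
  proof (rule Bochner_Integration.integral_cong[OF refl])
    fix s
    have "e w (s + t) = e w s * e w t" for t
      by (simp add: e_def algebra_simps flip: exp_add)
    then show "(LINT t|lborel. e w t * (f s * g (t - s))) = e w s * f s * (LINT t|lborel. e w t * g t)"
      by (subst lborel_integral_real_affine[of 1 _ s]) (simp_all add: mult_ac flip: integral_mult_right_zero)
  qed
  finally show "(LINT t|lborel. exp (- \<i> * of_real (w * t)) * (LINT s|lborel. f s * g (t - s)))
     = (LINT t|lborel. exp (- \<i> * of_real (w * t)) * f t) * (LINT t|lborel. exp (- \<i> * of_real (w * t)) * g t)"
    by (simp add: e_def)
qed

lemma integrable_power_exp:
  fixes p :: complex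
  assumes "Re p > 0"
  shows "integrable lborel (\<lambda>t. indicator {0..} t *\<^sub>R (of_real t ^ j * exp (- p * of_real t)))"
proof -
  have "integrable lborel (\<lambda>x::real. x ^ j * exp (- x) * indicator {0..} x)"
    using has_bochner_integral_I0i_power_exp_m'[of j] by (auto simp: has_bochner_integral_iff)
  then have "integrable lborel (\<lambda>t. (0 + Re p * t) ^ j * exp (- (0 + Re p * t)) * indicator {0..} (0 + Re p * t))"
    by (rule lborel_integrable_real_affine) (use assms in auto)
  then have "integrable lborel (\<lambda>t. (1 / Re p ^ j) * ((0 + Re p * t) ^ j * exp (- (0 + Re p * t)) * indicator {0..} (0 + Re p * t)))"
    by (rule integrable_mult_right)
  then show ?thesis
    by (rule Bochner_Integration.integrable_bound)
       (use assms in \<open>auto simp: norm_mult norm_power norm_exp_eq_Re power_mult_distrib indicator_def zero_le_mult_iff\<close>)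
qed

text \<open>Integrating the derivative of \<open>t\<^sup>j exp (- p t)\<close> over the half-line gives the recursion
\<open>j I(j - 1) - p I(j) = - 0\<^sup>j\<close>, whose right-hand side differs from zero only for \<open>j = 0\<close>.\<close>

lemma laplace_power:
  fixes p :: complex
  assumes p: "Re p > 0"
  shows "(LINT t|lborel. indicator {0..} t *\<^sub>R (of_real t ^ j * exp (- p * of_real t))) = fact j / p ^ Suc j"
proof -
  define f where "f j t = of_real t ^ j * exp (- p * of_real t)" for j t
  define I where "I j = (LINT t|lborel. indicator {0..} t *\<^sub>R f j t)" for j
  have p0: "p \<noteq> 0" using p by auto
  have int: "integrable lborel (\<lambda>t. indicator {0..} t *\<^sub>R f j t)" for j
    using integrable_power_exp[OF p] by (simp add: f_def)
  have int': "set_integrable lborel {0<..} (f j)" for j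
    by (rule set_integrable_subset[of lborel "{0..}"]) (use int in \<open>auto simp: set_integrable_def\<close>)
  have I: "I j = (LINT t:{0<..}|lborel. f j t)" for j
    unfolding I_def set_lebesgue_integral_def
    by (rule integral_cong_AE)
       (use AE_lborel_singleton[of 0] int[of j] int'[of j] in \<open>auto simp: set_integrable_def indicator_def elim!: eventually_mono\<close>)
  have step: "of_nat j * I (j - 1) - p * I j = - (0 ^ j)" for j
  proof -
    have "(LBINT t=ereal 0..\<infinity>. of_nat j * f (j - 1) t - p * f j t) = 0 - 0 ^ j"
    proof (rule interval_integral_FTC_integrable[where F = "f j"])
      show "(f j has_vector_derivative of_nat j * f (j - 1) t - p * f j t) (at t)" for t
        unfolding f_def
        by (rule derivative_eq_intros has_vector_derivative_of_real refl has_vector_derivative_real_field | simp)+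
      show "isCont (\<lambda>t. of_nat j * f (j - 1) t - p * f j t) t" for t
        unfolding f_def by (intro continuous_intros)
      show "set_integrable lborel (einterval (ereal 0) \<infinity>) (\<lambda>t. of_nat j * f (j - 1) t - p * f j t)"
        using int' by (auto intro!: set_integral_diff set_integrable_mult_right)
      have "((\<lambda>t. t ^ j * exp (- (Re p * t))) \<longlongrightarrow> 0) at_top"
        using p by real_asymp
      then have "(f j \<longlongrightarrow> 0) at_top"
        by (rule Lim_null_comparison[rotated])
           (auto intro!: eventually_mono[OF eventually_ge_at_top[of 0]] simp: f_def norm_mult norm_power norm_exp_eq_Re)
      then show "((f j \<circ> real_of_ereal) \<longlongrightarrow> 0) (at_left \<infinity>)"
        by (simp add: ereal_tendsto_simps)
      have "isCont (f j) 0" unfolding f_def by (intro continuous_intros)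
      then have "(f j \<longlongrightarrow> 0 ^ j) (at_right 0)"
        by (auto simp: isCont_def f_def intro: filterlim_mono[OF _ order_refl at_le])
      then show "((f j \<circ> real_of_ereal) \<longlongrightarrow> 0 ^ j) (at_right (ereal 0))"
        by (simp add: ereal_tendsto_simps)
    qed auto
    then show ?thesis
      unfolding interval_integral_to_infinity_eq I using int'
      by (simp add: set_integral_diff)
  qed
  have "I j = fact j / p ^ Suc j"
  proof (induction j)
    case 0
    show ?case using step[of 0] p0 by (simp add: field_simps)
  next
    case (Suc j)
    have "p * I (Suc j) = of_nat (Suc j) * I j"
      using step[of "Suc j"] by simp
    then have "I (Suc j) = of_nat (Suc j) * I j / p"
      using p0 by (simp add: field_simps)
    then show ?case
      unfolding Suc.IH by (simp add: mult.commute)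
  qed
  then show ?thesis by (simp add: I_def f_def)
qed

lemma fourier_anticausal_pole:
  assumes "Re a > 0"
  shows "\<exists>g. integrable lborel g \<and> (\<forall>w. (LINT t|lborel. exp (- \<i> * of_real (w * t)) * g t) = 1 / (\<i> * of_real w - a))"
proof (intro exI conjI allI)
  define g where "g t = - (indicator {0..} (- t) *\<^sub>R exp (a * of_real t))" for t :: real
  have "integrable lborel (\<lambda>t. indicator {0..} (- t) *\<^sub>R exp (a * of_real t))"
    using lborel_integrable_real_affine[OF integrable_power_exp[OF assms, of 0], of "-1" 0] by simp
  then show "integrable lborel g" unfolding g_def by auto
  fix w
  have "(LINT t|lborel. exp (- \<i> * of_real (w * t)) * g t) = (LINT t|lborel. exp (- \<i> * of_real (w * - t)) * g (- t))"
    using lborel_integral_real_affine[of "-1" "\<lambda>t. exp (- \<i> * of_real (w * t)) * g t" 0] by simp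
  also have "\<dots> = (LINT t|lborel. - (indicator {0..} t *\<^sub>R (of_real t ^ 0 * exp (- (a - \<i> * of_real w) * of_real t))))"
    by (intro Bochner_Integration.integral_cong refl)
       (auto simp: g_def indicator_def algebra_simps scaleR_conv_of_real simp flip: exp_add)
  also have "\<dots> = - (fact 0 / (a - \<i> * of_real w) ^ Suc 0)"
    using assms by (subst integral_minus, subst laplace_power) auto
  also have "\<dots> = 1 / (\<i> * of_real w - a)"
    by (simp add: divide_simps)
  finally show "(LINT t|lborel. exp (- \<i> * of_real (w * t)) * g t) = 1 / (\<i> * of_real w - a)" .
qed

lemma integrable_modulated:
  fixes g :: "real \<Rightarrow> complex"
  assumes g: "integrable lebesgue g"
  shows "integrable lebesgue (\<lambda>t. exp (- \<i> * of_real (w * t)) * g t)"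
proof (rule Bochner_Integration.integrable_bound[OF g])
  have [measurable]: "(\<lambda>t. exp (- \<i> * complex_of_real (w * t))) \<in> borel_measurable lebesgue"
    by (rule borel_measurable_lebesgueI) measurable
  show "(\<lambda>t. exp (- \<i> * of_real (w * t)) * g t) \<in> borel_measurable lebesgue"
    using borel_measurable_integrable[OF g] by measurable
qed (auto simp: norm_mult norm_exp_eq_Re)

lemma fourier_continuous:
  fixes g :: "real \<Rightarrow> complex"
  assumes g: "integrable lebesgue g"
  shows "continuous_on UNIV (\<lambda>w. LINT t|lebesgue. exp (- \<i> * of_real (w * t)) * g t)"
proof (intro continuous_at_imp_continuous_on ballI, unfold continuous_at_sequentially, intro allI impI)
  fix w :: real and v :: "nat \<Rightarrow> real"
  assume v: "v \<longlonglongrightarrow> w"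
  have meas: "(\<lambda>t. exp (- \<i> * of_real (u * t)) * g t) \<in> borel_measurable lebesgue" for u
    using integrable_modulated[OF g] by (rule borel_measurable_integrable)
  have "(\<lambda>n. LINT t|lebesgue. exp (- \<i> * of_real (v n * t)) * g t) \<longlonglongrightarrow> (LINT t|lebesgue. exp (- \<i> * of_real (w * t)) * g t)"
    by (rule integral_dominated_convergence[OF meas meas integrable_norm[OF g]])
       (auto simp: norm_mult norm_exp_eq_Re intro!: tendsto_intros v)
  then show "((\<lambda>w. LINT t|lebesgue. exp (- \<i> * of_real (w * t)) * g t) \<circ> v)
      \<longlonglongrightarrow> (LINT t|lebesgue. exp (- \<i> * of_real (w * t)) * g t)"
    by (simp add: o_def)
qed

lemma fourier_norm_le:
  fixes g :: "real \<Rightarrow> complex"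
  assumes g: "integrable lebesgue g"
  shows "norm (LINT t|lebesgue. exp (- \<i> * of_real (w * t)) * g t) \<le> (LINT t|lebesgue. norm (g t))"
proof -
  have "norm (LINT t|lebesgue. exp (- \<i> * of_real (w * t)) * g t)
      \<le> (LINT t|lebesgue. norm (exp (- \<i> * of_real (w * t)) * g t))"
    by (rule integral_norm_bound)
  then show ?thesis by (simp add: norm_mult)
qed

lemma fourier_rational:
  fixes d \<delta> :: "complex poly"
  assumes "degree d < degree \<delta>" and roots: "\<And>p. poly \<delta> p = 0 \<Longrightarrow> Re p > 0"
  shows "\<exists>g. integrable lborel g \<and> (\<forall>w. (LINT t|lborel. exp (- \<i> * of_real (w * t)) * g t)
    = poly d (\<i> * of_real w) / poly \<delta> (\<i> * of_real w))"
proof -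
  define S where "S = {G. \<exists>g. integrable lborel g \<and> (\<forall>w. (LINT t|lborel. exp (- \<i> * of_real (w * t)) * g t) = G w)}"
  have int: "integrable lborel (\<lambda>t. exp (- \<i> * of_real (w * t)) * g t)" if "integrable lborel g" for g :: "real \<Rightarrow> complex" and w
    using that by (rule Bochner_Integration.integrable_bound) (use that in \<open>auto simp: norm_mult\<close>)
  have "(\<lambda>w. poly d (\<i> * of_real w) / poly \<delta> (\<i> * of_real w)) \<in> S"
  proof (rule rational_induct)
    fix F G assume "F \<in> S" "G \<in> S"
    then obtain f g where fg: "integrable lborel f" "integrable lborel g"
        "\<And>w. (LINT t|lborel. exp (- \<i> * of_real (w * t)) * f t) = F w"
        "\<And>w. (LINT t|lborel. exp (- \<i> * of_real (w * t)) * g t) = G w"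
      unfolding S_def by blast
    have "(LINT t|lborel. exp (- \<i> * of_real (w * t)) * (f t + g t)) = F w + G w" for w
      unfolding fg(3,4)[symmetric] using int[OF fg(1)] int[OF fg(2)]
      by (subst Bochner_Integration.integral_add[symmetric]) (auto simp: distrib_left)
    then show "(\<lambda>w. F w + G w) \<in> S"
      unfolding S_def using fg(1,2) by (intro CollectI exI[of _ "\<lambda>t. f t + g t"]) auto
    show "(\<lambda>w. F w * G w) \<in> S"
      using fourier_convolution[OF fg(1,2)] unfolding fg(3,4) S_def by blast
  next
    fix F and c :: complex assume "F \<in> S"
    then obtain f where f: "integrable lborel f"
        "\<And>w. (LINT t|lborel. exp (- \<i> * of_real (w * t)) * f t) = F w"
      unfolding S_def by blast
    have "(LINT t|lborel. exp (- \<i> * of_real (w * t)) * (c * f t)) = c * F w" for w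
      unfolding f(2)[symmetric] by (simp add: mult.left_commute)
    then show "(\<lambda>w. c * F w) \<in> S"
      unfolding S_def using f(1) by (intro CollectI exI[of _ "\<lambda>t. c * f t"]) auto
  next
    fix a assume "poly \<delta> a = 0"
    then show "(\<lambda>w. 1 / (\<i> * of_real w - a)) \<in> S"
      unfolding S_def using fourier_anticausal_pole roots by blast
  qed (use assms roots in force)+
  then show ?thesis
    unfolding S_def by simp
qed

lemma borel_measurable_lebesgue_pair:
  assumes "f \<in> borel_measurable (borel \<Otimes>\<^sub>M N)"
  shows "f \<in> borel_measurable ((lebesgue :: real measure) \<Otimes>\<^sub>M N)"
proof -
  have "(\<lambda>p. (fst p, snd p)) \<in> (lebesgue :: real measure) \<Otimes>\<^sub>M N \<rightarrow>\<^sub>M borel \<Otimes>\<^sub>M N"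
    by (intro measurable_Pair measurable_compose[OF measurable_fst] measurable_snd)
       (auto intro: measurable_completion)
  from measurable_compose[OF this assms] show ?thesis by simp
qed

text \<open>Integrating a transform against a shifted Gaussian moves a Gaussian to the time side and leaves a
transform in the shift \<open>s\<close>. The right-hand side makes sense for square integrable \<open>C\<close> too, which
allows a passage to the limit from truncated functions.\<close>

lemma fourier_gaussian_test:
  fixes C :: "real \<Rightarrow> complex"
  assumes C: "integrable lebesgue C"
  shows "integrable lebesgue (\<lambda>w. (LINT t|lebesgue. exp (- \<i> * of_real (w * t)) * C t) * of_real (std_normal_density (w - s)))"
    and "(LINT w|lebesgue. (LINT t|lebesgue. exp (- \<i> * of_real (w * t)) * C t) * of_real (std_normal_density (w - s)))
       = (LINT t|lebesgue. exp (- \<i> * of_real (s * t)) * (of_real (exp (- t\<^sup>2 / 2)) * C t))"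
proof -
  define H where "H w t = exp (- \<i> * complex_of_real (w * t)) * of_real (std_normal_density (w - s))" for w t
  have H_borel: "(\<lambda>(w, t). H w t) \<in> borel_measurable (borel \<Otimes>\<^sub>M borel)"
    unfolding H_def by measurable
  have bd: "(\<integral>\<^sup>+w. ennreal (norm (H w t)) \<partial>lebesgue) \<le> ennreal 1" for t
  proof -
    have "(\<integral>\<^sup>+w. ennreal (norm (H w t)) \<partial>lebesgue) = (\<integral>\<^sup>+w. ennreal (std_normal_density (w - s)) \<partial>lborel)"
      by (simp add: H_def norm_mult normal_density_nonneg nn_integral_completion norm_exp_eq_Re)
    also have "\<dots> = (\<integral>\<^sup>+w. ennreal (std_normal_density w) \<partial>lborel)"
      by (subst nn_integral_real_affine[where c = 1 and t = s]) auto
    finally show ?thesis by (simp add: nn_integral_std_normal)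
  qed
  have inner: "(LINT w|lebesgue. H w t) = exp (- \<i> * of_real (s * t)) * of_real (exp (- t\<^sup>2 / 2))" for t
  proof -
    have "(LINT w|lebesgue. H w t) = (LINT w|lborel. H w t)"
      unfolding H_def by (rule integral_completion) measurable
    also have "\<dots> = (LINT v|lborel. exp (- \<i> * of_real (s * t)) * (of_real (std_normal_density v) * exp (\<i> * of_real ((- t) * v))))"
      by (subst lborel_integral_real_affine[of 1 _ s])
         (auto simp: H_def algebra_simps simp flip: exp_add intro!: Bochner_Integration.integral_cong)
    also have "\<dots> = exp (- \<i> * of_real (s * t)) * of_real (sqrt (2 * pi) * std_normal_density (- t))"
      by (simp only: integral_mult_right_zero char_gaussian)
    finally show ?thesis by (simp add: std_normal_density_def)
  qed
  note F = Fubini_kernel[OF sigma_finite_lebesgue sigma_finite_lebesgue C measurable_completion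
      borel_measurable_lebesgue_pair[OF H_borel] bd, of "\<lambda>t. t", simplified]
  have outer: "(LINT t|lebesgue. H w t * C t) = (LINT t|lebesgue. exp (- \<i> * of_real (w * t)) * C t) * of_real (std_normal_density (w - s))" for w
  proof -
    have "H w t * C t = (exp (- \<i> * of_real (w * t)) * C t) * of_real (std_normal_density (w - s))" for t
      by (simp add: H_def)
    then show ?thesis by (simp only: integral_mult_left_zero)
  qed
  show "integrable lebesgue (\<lambda>w. (LINT t|lebesgue. exp (- \<i> * of_real (w * t)) * C t) * of_real (std_normal_density (w - s)))"
    using F(1) unfolding outer .
  show "(LINT w|lebesgue. (LINT t|lebesgue. exp (- \<i> * of_real (w * t)) * C t) * of_real (std_normal_density (w - s)))
       = (LINT t|lebesgue. exp (- \<i> * of_real (s * t)) * (of_real (exp (- t\<^sup>2 / 2)) * C t))"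
    using F(2) unfolding outer inner by (simp add: mult.assoc)
qed

lemma L_norm_2_less:
  fixes f :: "real \<Rightarrow> complex"
  assumes "L_norm 2 f < ereal r"
  shows "f \<in> borel_measurable lebesgue" and "integrable lebesgue (\<lambda>t. (norm (f t))\<^sup>2)"
    and "(LINT t|lebesgue. (norm (f t))\<^sup>2) \<le> r\<^sup>2"
proof -
  define I where "I = (\<integral>\<^sup>+t. ennreal ((norm (f t))\<^sup>2) \<partial>lebesgue)"
  have two: "real_of_ereal 2 = 2" by simp
  have I_eq: "(\<integral>\<^sup>+t. ennreal (norm (f t) powr 2) \<partial>lebesgue) = I"
    unfolding I_def by (intro nn_integral_cong) simp
  show meas [measurable]: "f \<in> borel_measurable lebesgue"
    using assms by (auto simp: L_norm_def split: if_splits)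
  have *: "I \<noteq> \<infinity>" "enn2real I powr (1 / 2) < r"
    using assms unfolding L_norm_def Let_def two I_eq by (auto split: if_splits)
  show i: "integrable lebesgue (\<lambda>t. (norm (f t))\<^sup>2)"
    using *(1) by (intro integrableI_bounded) (auto simp: I_def less_top)
  have "(LINT t|lebesgue. (norm (f t))\<^sup>2) = enn2real I"
    unfolding I_def by (intro integral_eq_nn_integral) auto
  also have "\<dots> = (enn2real I powr (1 / 2))\<^sup>2"
    by (simp add: powr_half_sqrt)
  also have "\<dots> \<le> r\<^sup>2"
    using *(2) by (intro power_mono) auto
  finally show "(LINT t|lebesgue. (norm (f t))\<^sup>2) \<le> r\<^sup>2" .
qed

text \<open>A Cauchy-Schwarz estimate in the form \<open>2 \<bar>f\<bar> n \<le> \<bar>f\<bar>\<^sup>2 / r + r n\<^sup>2\<close>, where the density \<open>n\<close> satisfies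
\<open>n\<^sup>2 \<le> n\<close> and has integral one.\<close>

lemma integral_gaussian_bound:
  fixes f :: "real \<Rightarrow> complex"
  assumes L: "L_norm 2 f < ereal r"
  shows "norm (LINT w|lebesgue. f w * of_real (std_normal_density (w - s))) \<le> r"
proof -
  note [measurable] = L_norm_2_less(1)[OF L]
  have r: "r > 0"
  proof -
    have "0 \<le> L_norm 2 f" unfolding L_norm_def Let_def by auto
    then show ?thesis using L by (meson ereal_less(2) order_le_less_trans)
  qed
  have n_int: "integrable lebesgue (\<lambda>w. std_normal_density (w - s))" "(LINT w|lebesgue. std_normal_density (w - s)) = 1"
  proof -
    have "integrable lborel (\<lambda>w. std_normal_density (- s + 1 * w))"
      by (rule lborel_integrable_real_affine) (auto simp: integrable_std_normal_moment[of 0, simplified])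
    then show "integrable lebesgue (\<lambda>w. std_normal_density (w - s))"
      by (intro integrable_completion[THEN iffD2]) simp_all
    have "(LINT w|lebesgue. std_normal_density (w - s)) = (LINT w|lborel. std_normal_density (w - s))"
      by (rule integral_completion) simp
    also have "\<dots> = (LINT w|lborel. std_normal_density w)"
      by (subst lborel_integral_real_affine[of 1 _ s]) auto
    finally show "(LINT w|lebesgue. std_normal_density (w - s)) = 1"
      using integral_std_normal_moment_even[of 0] by simp
  qed
  have le: "norm (f w * of_real (std_normal_density (w - s))) \<le> ((norm (f w))\<^sup>2 / r + r * std_normal_density (w - s)) / 2" for w
  proof -
    let ?n = "std_normal_density (w - s)"
    have "0 \<le> (norm (f w) - r * ?n)\<^sup>2 / r" using r by simp
    also have "\<dots> = (norm (f w))\<^sup>2 / r - 2 * (norm (f w) * ?n) + r * ?n\<^sup>2"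
      using r by (simp add: power2_eq_square field_simps)
    also have "?n\<^sup>2 \<le> ?n"
      using std_normal_le_1[of "w - s"] by (simp add: power2_eq_square mult_left_le normal_density_nonneg)
    finally show ?thesis using r by (simp add: norm_mult normal_density_nonneg)
  qed
  have "norm (LINT w|lebesgue. f w * of_real (std_normal_density (w - s)))
      \<le> (LINT w|lebesgue. ((norm (f w))\<^sup>2 / r + r * std_normal_density (w - s)) / 2)"
  proof (rule Bochner_Integration.integral_norm_bound_integral)
    show i: "integrable lebesgue (\<lambda>w. ((norm (f w))\<^sup>2 / r + r * std_normal_density (w - s)) / 2)"
      using L_norm_2_less(2)[OF L] n_int(1) by auto
    show "integrable lebesgue (\<lambda>w. f w * of_real (std_normal_density (w - s)))"
    proof (rule Bochner_Integration.integrable_bound[OF i])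
      show "(\<lambda>w. f w * of_real (std_normal_density (w - s))) \<in> borel_measurable lebesgue"
        using borel_measurable_integrable[OF n_int(1)] by measurable
      show "AE w in lebesgue. norm (f w * of_real (std_normal_density (w - s))) \<le> norm (((norm (f w))\<^sup>2 / r + r * std_normal_density (w - s)) / 2)"
        unfolding real_norm_def by (intro AE_I2 order_trans[OF le abs_ge_self])
    qed
  qed (rule le)
  also have "\<dots> = ((LINT w|lebesgue. (norm (f w))\<^sup>2) / r + r) / 2"
    using L_norm_2_less(2)[OF L] n_int by simp
  also have "\<dots> \<le> (r\<^sup>2 / r + r) / 2"
    using L_norm_2_less(3)[OF L] r by (intro divide_right_mono add_mono) auto
  also have "\<dots> = r" using r by (simp add: power2_eq_square)
  finally show ?thesis .
qed

text \<open>When \<open>K\<close> is only known as the \<open>L\<^sub>2\<close>-limit of the transforms of the truncations of \<open>k\<close>, its integrals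
against shifted Gaussians are limits of those of the truncated transforms. Rewritten on the time
side by \<open>fourier_gaussian_test\<close>, this says that the integrable function \<open>exp (- t\<^sup>2 / 2) (k - k0)\<close> has zero transform, so \<open>k = k0\<close> almost everywhere.\<close>

lemma has_fourier_imp_integrable:
  fixes k :: "real \<Rightarrow> real" and k0 K :: "real \<Rightarrow> complex"
  assumes k0: "integrable lborel k0" and K: "\<And>w. (LINT t|lborel. exp (- \<i> * of_real (w * t)) * k0 t) = K w"
    and k: "has_fourier k K"
  shows "integrable lebesgue k" and "K w = (LINT t|lebesgue. exp (- \<i> * of_real (w * t)) * of_real (k t))"
proof -
  consider (L1) "in_L 1 k" "\<forall>w. K w = (LINT t|lebesgue. exp (- \<i> * of_real (w * t)) * of_real (k t))"
    | (L2) "in_L 2 k" "((\<lambda>T. L_norm 2 (\<lambda>w. K w -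
           (LINT t:{-T..T}|lebesgue. exp (- \<i> * of_real (w * t)) * of_real (k t)))) \<longlongrightarrow> 0) at_top"
    using k unfolding has_fourier_def by blast
  then have "integrable lebesgue k \<and> (\<forall>w. K w = (LINT t|lebesgue. exp (- \<i> * of_real (w * t)) * of_real (k t)))"
  proof cases
    case L1
    then show ?thesis using in_L_1_integrable by blast
  next
    case L2
    have k_meas [measurable]: "k \<in> borel_measurable lebesgue"
      using L2(1) by (simp add: in_L_def)
    have k_sq: "integrable lebesgue (\<lambda>t. (k t)\<^sup>2)"
    proof -
      have two: "real_of_ereal 2 = 2" by simp
      have "(\<integral>\<^sup>+t. ennreal (norm (k t) powr 2) \<partial>lebesgue) < \<infinity>"
        using L2(1) unfolding in_L_def L_norm_def Let_def two by (auto simp: less_top split: if_splits)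
      then show ?thesis
        by (intro integrableI_bounded) auto
    qed
    have k0': "integrable lebesgue k0" and K': "(LINT t|lebesgue. exp (- \<i> * of_real (w * t)) * k0 t) = K w" for w
      using k0 K[of w] by (auto simp: integrable_completion integral_completion)
    define \<gamma> where "\<gamma> t = exp (- t\<^sup>2 / 2)" for t :: real
    have \<gamma>_meas [measurable]: "\<gamma> \<in> borel_measurable lebesgue"
      unfolding \<gamma>_def by (rule borel_measurable_lebesgueI) measurable
    have \<gamma>_le: "0 \<le> \<gamma> t" "\<gamma> t \<le> 1" for t by (auto simp: \<gamma>_def)
    have \<gamma>_int: "integrable lebesgue \<gamma>"
    proof -
      have "integrable lborel (\<lambda>t. sqrt (2 * pi) * std_normal_density t)"
        using integrable_std_normal_moment[of 0] by simp
      then have "integrable lborel \<gamma>" by (simp add: \<gamma>_def[abs_def] std_normal_density_def)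
      then show ?thesis by (simp add: integrable_completion)
    qed
    have k\<gamma>_int: "integrable lebesgue (\<lambda>t. complex_of_real (\<gamma> t) * of_real (k t))"
    proof (rule Bochner_Integration.integrable_bound)
      show "integrable lebesgue (\<lambda>t. (k t)\<^sup>2 + \<gamma> t)" using k_sq \<gamma>_int by simp
      have "\<gamma> t * \<bar>k t\<bar> \<le> (k t)\<^sup>2 + \<gamma> t" for t
      proof -
        have "0 \<le> (\<bar>k t\<bar> - \<gamma> t / 2)\<^sup>2" by simp
        then have "\<gamma> t * \<bar>k t\<bar> \<le> (k t)\<^sup>2 + \<gamma> t * \<gamma> t / 4" by (simp add: power2_eq_square algebra_simps)
        also have "\<gamma> t * \<gamma> t / 4 \<le> \<gamma> t" using mult_left_le[OF \<gamma>_le(2) \<gamma>_le(1), of t t] \<gamma>_le(1)[of t] by linarith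
        finally show ?thesis by simp
      qed
      then show "AE t in lebesgue. norm (complex_of_real (\<gamma> t) * of_real (k t)) \<le> norm ((k t)\<^sup>2 + \<gamma> t)"
        using \<gamma>_le by (auto simp: norm_mult)
    qed measurable
    have k0\<gamma>_int: "integrable lebesgue (\<lambda>t. complex_of_real (\<gamma> t) * k0 t)"
    proof (rule Bochner_Integration.integrable_bound[OF k0'])
      show "(\<lambda>t. complex_of_real (\<gamma> t) * k0 t) \<in> borel_measurable lebesgue"
        using borel_measurable_integrable[OF k0'] by measurable
      show "AE t in lebesgue. norm (complex_of_real (\<gamma> t) * k0 t) \<le> norm (k0 t)"
        using \<gamma>_le by (auto simp: norm_mult intro!: mult_left_le_one_le)
    qed
    define kT where "kT n t = indicator {- real n..real n} t *\<^sub>R complex_of_real (k t)" for n t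
    have kT_int: "integrable lebesgue (kT n)" for n
    proof (rule Bochner_Integration.integrable_bound)
      show "integrable lebesgue (\<lambda>t. (k t)\<^sup>2 + indicator {- real n..real n} t)"
        using k_sq by (intro Bochner_Integration.integrable_add) (auto simp: emeasure_lborel_Icc_eq)
      have "\<bar>x\<bar> \<le> x\<^sup>2 + 1" for x :: real
      proof -
        have "0 \<le> (\<bar>x\<bar> - 1 / 2)\<^sup>2" by simp
        also have "\<dots> = x\<^sup>2 - \<bar>x\<bar> + 1 / 4" by (simp add: power2_eq_square algebra_simps)
        finally show ?thesis by simp
      qed
      then show "AE t in lebesgue. norm (kT n t) \<le> norm ((k t)\<^sup>2 + indicator {- real n..real n} t)"
        by (auto simp: kT_def indicator_def)
      have [measurable]: "(\<lambda>t. indicator {- real n..real n} t :: real) \<in> borel_measurable lebesgue"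
        by (rule borel_measurable_lebesgueI) measurable
      show "kT n \<in> borel_measurable lebesgue"
        unfolding kT_def[abs_def] by measurable
    qed
    have zero: "(LINT t|lebesgue. exp (- \<i> * of_real (s * t)) * (of_real (\<gamma> t) * (of_real (k t) - k0 t))) = 0" for s
    proof -
      define V where "V n w = (LINT t|lebesgue. exp (- \<i> * of_real (w * t)) * kT n t)" for n w
      define J where "J n = (LINT w|lebesgue. (K w - V n w) * of_real (std_normal_density (w - s)))" for n
      have "(\<lambda>n. L_norm 2 (\<lambda>w. K w - V n w)) \<longlonglongrightarrow> 0"
        using filterlim_compose[OF L2(2) filterlim_real_sequentially]
        unfolding V_def kT_def set_lebesgue_integral_def by simp
      then have ev: "\<forall>\<^sub>F n in sequentially. L_norm 2 (\<lambda>w. K w - V n w) < ereal e" if "e > 0" for e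
        by (rule order_tendstoD(2)) (use that in simp)
      have J_le: "\<forall>\<^sub>F n in sequentially. norm (J n) \<le> e" if "e > 0" for e
        unfolding J_def using ev[OF that] by (rule eventually_mono) (rule integral_gaussian_bound)
      have J0: "J \<longlonglongrightarrow> 0"
      proof (intro tendstoI)
        fix e :: real assume e: "e > 0"
        then have "\<forall>\<^sub>F n in sequentially. norm (J n) \<le> e / 2" by (intro J_le) simp
        then show "\<forall>\<^sub>F n in sequentially. dist (J n) 0 < e"
          using e by (auto elim!: eventually_mono)
      qed
      have J: "J n = (LINT t|lebesgue. exp (- \<i> * of_real (s * t)) * (of_real (\<gamma> t) * k0 t))
            - (LINT t|lebesgue. exp (- \<i> * of_real (s * t)) * (of_real (\<gamma> t) * kT n t))" for n
      proof -
        note A = fourier_gaussian_test[OF k0', of s, unfolded K', folded \<gamma>_def]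
          and B = fourier_gaussian_test[OF kT_int[of n], of s, folded V_def \<gamma>_def]
        show ?thesis
          unfolding J_def left_diff_distrib A(2)[symmetric] B(2)[symmetric]
          by (rule Bochner_Integration.integral_diff[OF A(1) B(1)])
      qed
      have "(\<lambda>n. LINT t|lebesgue. exp (- \<i> * of_real (s * t)) * (of_real (\<gamma> t) * kT n t))
          \<longlonglongrightarrow> (LINT t|lebesgue. exp (- \<i> * of_real (s * t)) * (of_real (\<gamma> t) * of_real (k t)))"
      proof (rule integral_dominated_convergence[where w = "\<lambda>t. norm (complex_of_real (\<gamma> t) * of_real (k t))"])
        have e_meas [measurable]: "(\<lambda>t. exp (- \<i> * complex_of_real (s * t))) \<in> borel_measurable lebesgue"
          by (rule borel_measurable_lebesgueI) measurable
        show "(\<lambda>t. exp (- \<i> * of_real (s * t)) * (of_real (\<gamma> t) * of_real (k t))) \<in> borel_measurable lebesgue"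
          by measurable
        show "(\<lambda>t. exp (- \<i> * of_real (s * t)) * (of_real (\<gamma> t) * kT n t)) \<in> borel_measurable lebesgue" for n
          using borel_measurable_integrable[OF kT_int] by measurable
        show "AE t in lebesgue. (\<lambda>n. exp (- \<i> * of_real (s * t)) * (of_real (\<gamma> t) * kT n t))
            \<longlonglongrightarrow> exp (- \<i> * of_real (s * t)) * (of_real (\<gamma> t) * of_real (k t))"
        proof (rule AE_I2, intro tendsto_mult tendsto_const)
          fix t
          have "\<forall>\<^sub>F n in sequentially. kT n t = of_real (k t)"
            using eventually_ge_at_top[of "nat \<lceil>\<bar>t\<bar>\<rceil>"]
          proof eventually_elim
            case (elim n)
            then have "\<bar>t\<bar> \<le> real n" by linarith
            then have "t \<in> {- real n..real n}" by auto
          then show ?case by (simp add: kT_def)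
          qed
          then show "(\<lambda>n. kT n t) \<longlonglongrightarrow> of_real (k t)" by (rule tendsto_eventually)
        qed
        show "AE t in lebesgue. norm (exp (- \<i> * of_real (s * t)) * (of_real (\<gamma> t) * kT n t))
            \<le> norm (complex_of_real (\<gamma> t) * of_real (k t))" for n
          by (auto simp: norm_mult kT_def indicator_def norm_exp_eq_Re)
      qed (use k\<gamma>_int in auto)
      then have "J \<longlonglongrightarrow> (LINT t|lebesgue. exp (- \<i> * of_real (s * t)) * (of_real (\<gamma> t) * k0 t))
            - (LINT t|lebesgue. exp (- \<i> * of_real (s * t)) * (of_real (\<gamma> t) * of_real (k t)))"
        unfolding J by (intro tendsto_intros)
      then have eq: "(LINT t|lebesgue. exp (- \<i> * of_real (s * t)) * (of_real (\<gamma> t) * k0 t))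
            = (LINT t|lebesgue. exp (- \<i> * of_real (s * t)) * (of_real (\<gamma> t) * of_real (k t)))"
        using LIMSEQ_unique[OF J0] by fastforce
      have "(LINT t|lebesgue. exp (- \<i> * of_real (s * t)) * (of_real (\<gamma> t) * of_real (k t))
          - exp (- \<i> * of_real (s * t)) * (of_real (\<gamma> t) * k0 t)) = 0"
        using Bochner_Integration.integral_diff[OF integrable_modulated[OF k\<gamma>_int] integrable_modulated[OF k0\<gamma>_int]] eq by simp
      then show ?thesis by (simp add: right_diff_distrib)
    qed
    have "integrable lebesgue (\<lambda>t. complex_of_real (\<gamma> t) * (of_real (k t) - k0 t))"
      using Bochner_Integration.integrable_diff[OF k\<gamma>_int k0\<gamma>_int] by (simp add: right_diff_distrib)
    from AE_zero_of_fourier_zero[OF this zero]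
    have AE: "AE t in lebesgue. k0 t = of_real (k t)"
      by (auto simp: \<gamma>_def elim!: eventually_mono)
    have "integrable lebesgue (\<lambda>t. complex_of_real (k t))"
      by (rule integrable_cong_AE_imp[OF k0']) (use AE in \<open>auto elim!: eventually_mono\<close>)
    then have "integrable lebesgue (\<lambda>t. Re (complex_of_real (k t)))"
      by (rule integrable_Re)
    moreover have "K w = (LINT t|lebesgue. exp (- \<i> * of_real (w * t)) * of_real (k t))" for w
      unfolding K'[symmetric]
    proof (rule integral_cong_AE)
      have [measurable]: "(\<lambda>t. exp (- \<i> * complex_of_real (w * t))) \<in> borel_measurable lebesgue"
        by (rule borel_measurable_lebesgueI) measurable
      show "(\<lambda>t. exp (- \<i> * complex_of_real (w * t)) * k0 t) \<in> borel_measurable lebesgue"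
        using borel_measurable_integrable[OF k0'] by measurable
      show "(\<lambda>t. exp (- \<i> * complex_of_real (w * t)) * of_real (k t)) \<in> borel_measurable lebesgue"
        by measurable
    qed (use AE in \<open>auto elim!: eventually_mono\<close>)
    ultimately show ?thesis by simp
  qed
  then show "integrable lebesgue k" and "K w = (LINT t|lebesgue. exp (- \<i> * of_real (w * t)) * of_real (k t))"
    by auto
qed

lemma anticausal_kernel_fourier:
  assumes k: "k \<in> anticausal_kernels \<Omega>" and D: "closed D" "\<Omega> \<notin> D"
  shows "integrable lebesgue k"
    and "(\<lambda>w. LINT t|lebesgue. exp (- \<i> * of_real (w * t)) * of_real (k t)) \<in> causal_approx D"
proof -
  obtain d \<delta> :: "complex poly" where deg: "degree d < degree \<delta>"
    and roots: "\<And>p. poly \<delta> p = 0 \<Longrightarrow> Re p > 0"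
    and fourier: "has_fourier k (\<lambda>w. poly d (\<i> * of_real w) / poly \<delta> (\<i> * of_real w))"
    using k unfolding anticausal_kernels_def by blast
  obtain k0 where k0: "integrable lborel k0"
      "\<And>w. (LINT t|lborel. exp (- \<i> * of_real (w * t)) * k0 t) = poly d (\<i> * of_real w) / poly \<delta> (\<i> * of_real w)"
    using fourier_rational[OF deg roots] by blast
  show "integrable lebesgue k"
    by (rule has_fourier_imp_integrable(1)[OF k0 fourier])
  have "(\<lambda>w. poly d (\<i> * of_real w) / poly \<delta> (\<i> * of_real w)) \<in> causal_approx D"
    by (rule rational_induct[OF causal_approx_add causal_approx_smult causal_approx_mult causal_approx_pole[OF D roots] _ deg])
       (use roots in force)+
  then show "(\<lambda>w. LINT t|lebesgue. exp (- \<i> * of_real (w * t)) * of_real (k t)) \<in> causal_approx D"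
    unfolding has_fourier_imp_integrable(2)[OF k0 fourier] .
qed

section \<open>Causal kernels with prescribed transforms\<close>

text \<open>The normalisation by \<open>j!\<close> makes \<open>coeff r j\<close> the coefficient of \<open>1 / (1 + p)\<^sup>j\<^sup>+\<^sup>1\<close> in the transform.\<close>

definition laguerre_kernel :: "real poly \<Rightarrow> real \<Rightarrow> real" where
  "laguerre_kernel r t = (if t < 0 then 0 else (\<Sum>j\<le>degree r. coeff r j * (t ^ j / fact j)) * exp (- t))"

lemma laguerre_kernel_measurable [measurable]: "laguerre_kernel r \<in> borel_measurable borel"
  unfolding laguerre_kernel_def[abs_def] by measurable

lemma power_div_fact_le_exp: "0 \<le> t \<Longrightarrow> t ^ j / fact j \<le> exp (t :: real)"
proof -
  assume t: "0 \<le> t"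
  have "(\<Sum>n\<in>{j}. t ^ n /\<^sub>R fact n) \<le> (\<Sum>n. t ^ n /\<^sub>R fact n)"
    using t exp_converges[of t] by (intro sum_le_suminf) (auto simp: sums_iff)
  also have "\<dots> = exp t" using exp_converges[of t] by (simp add: sums_iff)
  finally show ?thesis by (simp add: divide_inverse mult.commute)
qed

lemma laguerre_kernel_bounded: "\<bar>laguerre_kernel r t\<bar> \<le> (\<Sum>j\<le>degree r. \<bar>coeff r j\<bar>)"
proof (cases "t < 0")
  case False
  have "\<bar>\<Sum>j\<le>degree r. coeff r j * (t ^ j / fact j)\<bar> \<le> (\<Sum>j\<le>degree r. \<bar>coeff r j\<bar> * exp t)"
  proof (rule order_trans[OF sum_abs], rule sum_mono)
    fix j
    have "\<bar>t ^ j / fact j\<bar> \<le> exp t"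
      using power_div_fact_le_exp[of t j] False by simp
    then show "\<bar>coeff r j * (t ^ j / fact j)\<bar> \<le> \<bar>coeff r j\<bar> * exp t"
      unfolding abs_mult by (rule mult_left_mono) simp
  qed
  then have "\<bar>\<Sum>j\<le>degree r. coeff r j * (t ^ j / fact j)\<bar> * exp (- t) \<le> (\<Sum>j\<le>degree r. \<bar>coeff r j\<bar>) * exp t * exp (- t)"
    unfolding sum_distrib_right[symmetric] by (rule mult_right_mono) simp
  also have "\<dots> = (\<Sum>j\<le>degree r. \<bar>coeff r j\<bar>)" by (simp add: mult.assoc flip: exp_add)
  finally show ?thesis using False by (simp add: laguerre_kernel_def abs_mult)
qed (auto simp: laguerre_kernel_def intro: sum_nonneg)

lemma
  fixes p :: complex
  assumes p: "Re p > - 1"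
  shows integrable_laguerre_kernel: "integrable lebesgue (\<lambda>t. exp (- p * of_real t) * of_real (laguerre_kernel r t))"
    and laguerre_kernel_transform: "(LINT t|lebesgue. exp (- p * of_real t) * of_real (laguerre_kernel r t))
      = poly (map_poly of_real r) (1 / (1 + p)) / (1 + p)"
proof -
  define g where "g j t = indicator {0..} t *\<^sub>R (of_real t ^ j * exp (- (1 + p) * of_real t))" for j t
  have p': "Re (1 + p) > 0" using p by simp
  have eq: "exp (- p * of_real t) * of_real (laguerre_kernel r t)
      = (\<Sum>j\<le>degree r. of_real (coeff r j) / fact j * g j t)" for t
  proof (cases "t < 0")
    case False
    have "exp (- (1 + p) * of_real t) = exp (- p * of_real t) * of_real (exp (- t))"
      unfolding exp_of_real[symmetric] exp_add[symmetric] by (simp add: algebra_simps)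
    then have "of_real (coeff r j) / fact j * g j t
        = exp (- p * of_real t) * (of_real (coeff r j * (t ^ j / fact j)) * of_real (exp (- t)))" for j
      using False by (simp add: g_def)
    then have "(\<Sum>j\<le>degree r. of_real (coeff r j) / fact j * g j t)
        = exp (- p * of_real t) * ((\<Sum>j\<le>degree r. of_real (coeff r j * (t ^ j / fact j))) * of_real (exp (- t)))"
      by (simp only: sum_distrib_left[symmetric] sum_distrib_right[symmetric])
    then show ?thesis
      using False by (simp add: laguerre_kernel_def)
  qed (simp add: laguerre_kernel_def g_def)
  have int: "integrable lborel (\<lambda>t. \<Sum>j\<le>degree r. of_real (coeff r j) / fact j * g j t)"
    unfolding g_def by (intro Bochner_Integration.integrable_sum integrable_mult_right integrable_power_exp[OF p'])
  show "integrable lebesgue (\<lambda>t. exp (- p * of_real t) * of_real (laguerre_kernel r t))"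
    unfolding eq using int by (simp add: integrable_completion)
  have "(LINT t|lebesgue. exp (- p * of_real t) * of_real (laguerre_kernel r t))
      = (LINT t|lborel. (\<Sum>j\<le>degree r. of_real (coeff r j) / fact j * g j t))"
    unfolding eq by (rule integral_completion) (use int in simp)
  also have "\<dots> = (\<Sum>j\<le>degree r. of_real (coeff r j) / fact j * (fact j / (1 + p) ^ Suc j))"
    unfolding g_def
    by (subst Bochner_Integration.integral_sum)
      (simp_all only: integral_mult_right_zero laplace_power[OF p'] integrable_mult_right integrable_power_exp[OF p'])
  also have "\<dots> = poly (map_poly of_real r) (1 / (1 + p)) / (1 + p)"
    by (simp add: poly_altdef coeff_map_poly degree_map_poly sum_divide_distrib power_one_over mult.commute)
  finally show "(LINT t|lebesgue. exp (- p * of_real t) * of_real (laguerre_kernel r t))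
      = poly (map_poly of_real r) (1 / (1 + p)) / (1 + p)" .
qed

lemma integrable_laguerre_kernel_real: "integrable lebesgue (laguerre_kernel r)"
  using integrable_Re[OF integrable_laguerre_kernel[of 0 r]] by simp

lemma laguerre_kernel_in_L_2: "in_L 2 (laguerre_kernel r)"
proof -
  define B where "B = (\<Sum>j\<le>degree r. \<bar>coeff r j\<bar>)"
  have two: "real_of_ereal 2 = 2" by simp
  have "(\<integral>\<^sup>+t. ennreal (norm (laguerre_kernel r t) powr 2) \<partial>lebesgue)
      \<le> (\<integral>\<^sup>+t. ennreal (B * \<bar>laguerre_kernel r t\<bar>) \<partial>lebesgue)"
  proof (intro nn_integral_mono ennreal_leI)
    fix t
    have "\<bar>laguerre_kernel r t\<bar> * \<bar>laguerre_kernel r t\<bar> \<le> B * \<bar>laguerre_kernel r t\<bar>"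
      unfolding B_def by (rule mult_right_mono[OF laguerre_kernel_bounded]) simp
    then show "norm (laguerre_kernel r t) powr 2 \<le> B * \<bar>laguerre_kernel r t\<bar>"
      by (simp add: power2_eq_square)
  qed
  also have "\<dots> < \<infinity>"
    using integrable_mult_right[OF integrable_abs[OF integrable_laguerre_kernel_real[of r]], of B]
    by (subst nn_integral_eq_integral) (auto simp: B_def sum_nonneg)
  finally show ?thesis
    unfolding in_L_def L_norm_def Let_def two by (auto intro: borel_measurable_lebesgueI)
qed

lemma nn_integral_inverse_1_plus_square: "(\<integral>\<^sup>+w. ennreal (1 / (1 + w\<^sup>2)) \<partial>lebesgue) < \<infinity>"
proof -
  have "integrable lborel (\<lambda>w::real. inverse (1 + w\<^sup>2))"
    using integrable_inverse_1_plus_square by (simp add: set_integrable_def)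
  then have "integrable lebesgue (\<lambda>w::real. inverse (1 + w\<^sup>2))"
    by (simp add: integrable_completion)
  then show ?thesis
    by (subst nn_integral_eq_integral) (auto simp: inverse_eq_divide add_nonneg_nonneg)
qed

text \<open>On the right half-plane the transform is \<open>u q(u)\<close> with \<open>u = 1 / (1 + p)\<close> and \<open>\<bar>u\<bar> \<le> 1\<close>. On every
vertical line it is bounded by a multiple of \<open>1 / sqrt (1 + w\<^sup>2)\<close>, which is square integrable.\<close>

lemma laguerre_kernel_causal: "laguerre_kernel r \<in> causal_kernels"
proof -
  define q :: "complex poly" where "q = map_poly of_real r"
  have lap: "laplace (laguerre_kernel r) p = poly q (1 / (1 + p)) / (1 + p)" if "Re p > 0" for p
  proof -
    have "laplace (laguerre_kernel r) p = (LINT t|lebesgue. exp (- p * of_real t) * of_real (laguerre_kernel r t))"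
      unfolding laplace_def set_lebesgue_integral_def
      by (intro Bochner_Integration.integral_cong) (auto simp: indicator_def laguerre_kernel_def)
    then show ?thesis using laguerre_kernel_transform[of p r] that by (simp add: q_def)
  qed
  obtain B where B: "B > 0" "\<And>z. norm z \<le> 1 \<Longrightarrow> norm (poly q z) \<le> B"
    using poly_bound_exists[of 1 q] by blast
  have nz: "1 + p \<noteq> 0" if "Re p > 0" for p :: complex
    using that by (metis add_pos_pos less_irrefl one_complex.simps(1) plus_complex.simps(1) zero_complex.simps(1) zero_less_one)
  have ge: "sqrt (1 + w\<^sup>2) \<le> norm (1 + Complex s w)" if "s > 0" for s w
  proof -
    have "1 \<le> (1 + s)\<^sup>2" using that by (simp add: power2_eq_square algebra_simps)
    then show ?thesis by (simp add: cmod_def)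
  qed
  have norm_lap: "norm (laplace (laguerre_kernel r) (Complex s w)) \<le> B / sqrt (1 + w\<^sup>2)" if s: "s > 0" for s w
  proof -
    have "1 \<le> sqrt (1 + w\<^sup>2)" by simp
    then have "1 \<le> norm (1 + Complex s w)" using ge[OF s, of w] by linarith
    then have "norm (1 / (1 + Complex s w)) \<le> 1" by (simp add: norm_divide divide_le_eq)
    then have num: "norm (poly q (1 / (1 + Complex s w))) \<le> B" by (rule B(2))
    have "norm (poly q (1 / (1 + Complex s w))) / norm (1 + Complex s w) \<le> B / sqrt (1 + w\<^sup>2)"
      by (rule frac_le[OF less_imp_le[OF B(1)] num _ ge[OF s]])
        (rule less_le_trans[OF zero_less_one \<open>1 \<le> sqrt (1 + w\<^sup>2)\<close>])
    then show ?thesis using s by (simp add: lap norm_divide)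
  qed
  have meas: "(\<lambda>w. laplace (laguerre_kernel r) (Complex s w)) \<in> borel_measurable lebesgue" if s: "s > 0" for s
  proof -
    have nz': "1 + Complex s w \<noteq> 0" for w using nz[of "Complex s w"] s by simp
    have "continuous_on UNIV (\<lambda>w. 1 + Complex s w)"
      unfolding Complex_eq by (intro continuous_intros)
    then have "continuous_on UNIV (\<lambda>w. poly q (1 / (1 + Complex s w)) / (1 + Complex s w))"
      by (intro continuous_on_divide continuous_on_poly continuous_on_const) (use nz' in auto)
    then have "(\<lambda>w. poly q (1 / (1 + Complex s w)) / (1 + Complex s w)) \<in> borel_measurable lebesgue"
      by (intro borel_measurable_lebesgueI borel_measurable_continuous_onI)
    moreover have "laplace (laguerre_kernel r) (Complex s w) = poly q (1 / (1 + Complex s w)) / (1 + Complex s w)" for w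
      by (rule lap) (use s in simp)
    ultimately show ?thesis by simp
  qed
  have holo: "laplace (laguerre_kernel r) holomorphic_on {z. Re z > 0}"
  proof (rule holomorphic_transform[where f = "\<lambda>p. poly q (1 / (1 + p)) / (1 + p)"])
    show "(\<lambda>p. poly q (1 / (1 + p)) / (1 + p)) holomorphic_on {z. Re z > 0}"
      unfolding poly_altdef
      by (intro holomorphic_on_sum holomorphic_on_mult holomorphic_on_power holomorphic_on_divide
          holomorphic_on_add holomorphic_on_const holomorphic_on_ident) (use nz in auto)
  qed (simp add: lap)
  have "Hardy_norm \<infinity> (laplace (laguerre_kernel r)) \<le> ereal B"
    unfolding Hardy_norm_def
  proof (rule SUP_least)
    fix s :: real assume "s \<in> {0<..}"
    then have s: "s > 0" by simp
    have le: "norm (laplace (laguerre_kernel r) (Complex s w)) \<le> B" for w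
    proof -
      have "B / sqrt (1 + w\<^sup>2) \<le> B / 1" by (rule frac_le) (use B(1) in auto)
      then show ?thesis using norm_lap[OF s, of w] by simp
    qed
    show "L_norm \<infinity> (\<lambda>w. laplace (laguerre_kernel r) (Complex s w)) \<le> ereal B"
    proof -
      have "esssup lebesgue (\<lambda>w. ereal (norm (laplace (laguerre_kernel r) (Complex s w)))) \<le> ereal B"
      proof (rule esssup_I)
        show "(\<lambda>w. ereal (norm (laplace (laguerre_kernel r) (Complex s w)))) \<in> borel_measurable lebesgue"
          by (rule borel_measurable_ereal[OF measurable_compose[OF meas[OF s] borel_measurable_norm]])
      qed (simp add: le)
      then show ?thesis
        unfolding L_norm_def using meas[OF s] by simp
    qed
  qed
  moreover have "Hardy_norm 2 (laplace (laguerre_kernel r)) < \<infinity>"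
  proof -
    define I where "I = (\<integral>\<^sup>+w. ennreal (B\<^sup>2 * (1 / (1 + w\<^sup>2))) \<partial>lebesgue)"
    have "I = ennreal (B\<^sup>2) * (\<integral>\<^sup>+w. ennreal (1 / (1 + w\<^sup>2)) \<partial>lebesgue)"
      unfolding I_def by (subst nn_integral_cmult[symmetric])
        (auto simp: ennreal_mult'[symmetric] intro!: borel_measurable_lebesgueI)
    then have I: "I < \<infinity>"
      using nn_integral_inverse_1_plus_square by (simp add: ennreal_mult_less_top)
    have two: "real_of_ereal 2 = 2" by simp
    have "Hardy_norm 2 (laplace (laguerre_kernel r)) \<le> ereal (enn2real I powr (1 / 2))"
      unfolding Hardy_norm_def
    proof (rule SUP_least)
      fix s :: real assume "s \<in> {0<..}"
      then have s: "s > 0" by simp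
      have le: "(\<integral>\<^sup>+w. ennreal (norm (laplace (laguerre_kernel r) (Complex s w)) powr 2) \<partial>lebesgue) \<le> I"
        unfolding I_def
      proof (intro nn_integral_mono ennreal_leI)
        fix w
        have "(norm (laplace (laguerre_kernel r) (Complex s w)))\<^sup>2 \<le> (B / sqrt (1 + w\<^sup>2))\<^sup>2"
          using norm_lap[OF s, of w] by (intro power_mono) auto
        then show "norm (laplace (laguerre_kernel r) (Complex s w)) powr 2 \<le> B\<^sup>2 * (1 / (1 + w\<^sup>2))"
          by (simp add: power_divide add_nonneg_nonneg)
      qed
      then have "enn2real (\<integral>\<^sup>+w. ennreal (norm (laplace (laguerre_kernel r) (Complex s w)) powr 2) \<partial>lebesgue) powr (1 / 2)
          \<le> enn2real I powr (1 / 2)"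
        by (intro powr_mono2 enn2real_mono) (use I in auto)
      moreover have "(\<integral>\<^sup>+w. ennreal (norm (laplace (laguerre_kernel r) (Complex s w)) powr 2) \<partial>lebesgue) \<noteq> \<infinity>"
        using le I by (metis infinity_ennreal_def leD)
      moreover have "(2 :: ereal) \<noteq> \<infinity>" by simp
      ultimately show "L_norm 2 (\<lambda>w. laplace (laguerre_kernel r) (Complex s w)) \<le> ereal (enn2real I powr (1 / 2))"
        unfolding L_norm_def Let_def two by (simp only: meas[OF s] not_True_eq_False if_False ereal_less_eq)
    qed
    then show ?thesis by (rule order_le_less_trans) simp
  qed
  ultimately have "laplace (laguerre_kernel r) \<in> Hardy 2 \<inter> Hardy \<infinity>"
    unfolding Hardy_def using holo order_le_less_trans[of _ "ereal B" \<infinity>] by simp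
  then show ?thesis
    unfolding causal_kernels_def using laguerre_kernel_in_L_2 by (auto simp: laguerre_kernel_def)
qed

lemma fourier_uminus_real:
  fixes k :: "real \<Rightarrow> real"
  shows "(LINT t|lebesgue. exp (- \<i> * of_real (- w * t)) * of_real (k t))
    = cnj (LINT t|lebesgue. exp (- \<i> * of_real (w * t)) * of_real (k t))"
proof -
  have "exp (- \<i> * of_real (- w * t)) * of_real (k t) = cnj (exp (- \<i> * of_real (w * t)) * of_real (k t))" for t
    by (simp add: exp_cnj)
  then show ?thesis by (simp only: Bochner_Integration.integral_cnj)
qed

lemma fourier_laguerre_kernel:
  "(LINT t|lebesgue. exp (- \<i> * of_real (w * t)) * of_real (laguerre_kernel r t))
      = poly (map_poly of_real r) (1 / (1 + \<i> * of_real w)) / (1 + \<i> * of_real w)"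
  using laguerre_kernel_transform[of "\<i> * of_real w" r] by (simp add: mult.assoc)

text \<open>The approximating polynomial may have complex coefficients, but the predicting kernel has to be real.
The transform of a real kernel is conjugate symmetric, so on a symmetric set of frequencies the
approximation is as good after symmetrising, which replaces the coefficients by their real parts.\<close>

lemma causal_approx_real:
  fixes k :: "real \<Rightarrow> real"
  assumes approx: "(\<lambda>w. LINT t|lebesgue. exp (- \<i> * of_real (w * t)) * of_real (k t)) \<in> causal_approx D"
    and sym: "\<And>w. w \<in> D \<Longrightarrow> - w \<in> D" and e: "e > 0"
  obtains r where "\<And>w. w \<in> D \<Longrightarrow> norm ((LINT t|lebesgue. exp (- \<i> * of_real (w * t)) * of_real (k t))
       - (LINT t|lebesgue. exp (- \<i> * of_real (w * t)) * of_real (laguerre_kernel r t))) \<le> e"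
proof -
  define G where "G w = (LINT t|lebesgue. exp (- \<i> * of_real (w * t)) * of_real (k t))" for w
  obtain q where q: "\<And>w. w \<in> D \<Longrightarrow> norm (G w - poly q (1 / (1 + \<i> * of_real w)) / (1 + \<i> * of_real w)) \<le> e"
    using causal_approxE[OF approx e] unfolding G_def by blast
  define P where "P w = poly q (1 / (1 + \<i> * of_real w)) / (1 + \<i> * of_real w)" for w
  define r where "r = map_poly Re q"
  define T where "T w = poly (map_poly of_real r) (1 / (1 + \<i> * of_real w)) / (1 + \<i> * of_real w)" for w
  have qr: "smult 2 (map_poly of_real r) = q + map_poly cnj q"
    by (rule poly_eqI) (simp add: r_def coeff_map_poly complex_eq_iff)
  have T: "2 * T w = P w + cnj (P (- w))" for w
  proof -
    have "cnj (P (- w)) = poly (map_poly cnj q) (1 / (1 + \<i> * of_real w)) / (1 + \<i> * of_real w)"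
      by (simp only: P_def poly_cnj complex_cnj_divide complex_cnj_minus complex_cnj_add complex_cnj_mult complex_cnj_one
          complex_cnj_i complex_cnj_complex_of_real of_real_minus minus_mult_minus)
    moreover have "2 * T w = poly (smult 2 (map_poly of_real r)) (1 / (1 + \<i> * of_real w)) / (1 + \<i> * of_real w)"
      by (simp add: T_def)
    ultimately show ?thesis
      unfolding qr by (simp add: P_def add_divide_distrib)
  qed
  have G: "2 * G w = G w + cnj (G (- w))" for w
  proof -
    have "G (- w) = cnj (G w)" unfolding G_def by (rule fourier_uminus_real)
    then show ?thesis by simp
  qed
  have "norm (G w - T w) \<le> e" if w: "w \<in> D" for w
  proof -
    have "2 * (G w - T w) = (G w - P w) + cnj (G (- w) - P (- w))"
      using T[of w] G[of w] by (simp add: algebra_simps)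
    then have "norm (2 * (G w - T w)) \<le> norm (G w - P w) + norm (cnj (G (- w) - P (- w)))"
      using norm_triangle_ineq[of "G w - P w" "cnj (G (- w) - P (- w))"] by (simp only:)
    also have "\<dots> \<le> e + e"
      using q[OF w] q[OF sym[OF w]] unfolding P_def complex_mod_cnj by (rule add_mono)
    finally show ?thesis unfolding norm_mult by simp
  qed
  then show ?thesis
    unfolding G_def T_def fourier_laguerre_kernel[symmetric] by (rule that)
qed

section \<open>Predictability\<close>

lemma represents_spectral_data: "represents \<omega> c Xc x \<Longrightarrow> spectral_data c Xc"
  unfolding represents_def by (intro spectral_data.intro) (auto intro: in_L_1_integrable)

lemma represents_eq_pairing:
  assumes "represents \<omega> c Xc x"
  shows "x t = 1 / (2 * of_real pi) * spectral_data.pairing \<omega> c Xc (\<lambda>w. exp (\<i> * of_real (w * t)))"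
  using assms unfolding spectral_data.pairing_def[OF represents_spectral_data[OF assms]] represents_def
  by (simp add: distrib_left)

text \<open>The spectrum \<open>X\<close> may be given by another representation of \<open>x\<close>. By uniqueness its norm still bounds
the pairings of the representation at hand.\<close>

lemma is_spectrum_pairing:
  assumes rep: "represents \<omega> c Xc x" and X: "is_spectrum x X"
    and cont: "continuous_on UNIV f" and bd: "\<And>w. norm (f w) \<le> B"
  shows "norm (spectral_data.pairing \<omega> c Xc f) \<le> norm X * B"
proof -
  obtain \<omega>' c' Xc' where rep': "represents \<omega>' c' Xc' x"
    and X': "\<And>f. blinfun_apply X f = (\<Sum>k. c' k * apply_bcontfun f (\<omega>' k)) + (LINT w|lebesgue. apply_bcontfun f w * Xc' w)"
    using X unfolding is_spectrum_def by blast
  note sd = represents_spectral_data[OF rep] represents_spectral_data[OF rep']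
  have f: "apply_bcontfun (Bcontfun f) = f"
    using bcontfun_normI[OF cont bd] by (rule Bcontfun_inverse)
  have "spectral_data.pairing \<omega> c Xc f = spectral_data.pairing \<omega>' c' Xc' f"
  proof (rule pairing_unique[OF sd _ cont bd])
    show "spectral_data.pairing \<omega> c Xc (\<lambda>w. exp (\<i> * of_real (w * t))) =
         spectral_data.pairing \<omega>' c' Xc' (\<lambda>w. exp (\<i> * of_real (w * t)))" for t
      using represents_eq_pairing[OF rep, of t] represents_eq_pairing[OF rep', of t] by simp
  qed
  also have "\<dots> = blinfun_apply X (Bcontfun f)"
    unfolding X' f spectral_data.pairing_def[OF sd(2)] ..
  also have "norm \<dots> \<le> norm X * norm (Bcontfun f)"
    by (rule norm_blinfun)
  also have "\<dots> \<le> norm X * B"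
    by (intro mult_left_mono norm_bound) (simp_all add: f bd)
  finally show ?thesis .
qed

text \<open>The support condition is stated with a null set of exceptions, the form in which it can be used
under an integral.\<close>

definition spectrally_supported :: "real set \<Rightarrow> (real \<Rightarrow> complex) \<Rightarrow> bool" where
  "spectrally_supported D x \<longleftrightarrow> (\<exists>\<omega> c Xc. represents \<omega> c Xc x \<and> (\<forall>k. \<omega> k \<in> D)
     \<and> (AE w in lebesgue. w \<notin> D \<longrightarrow> Xc w = 0))"

text \<open>The complement of the support is a possibly uncountable union of open sets on which the function vanishes
almost everywhere; by the Lindelof property countably many of them suffice.\<close>

lemma AE_ess_support: "AE w in lebesgue. w \<notin> ess_support f \<longrightarrow> f w = 0"
proof -
  define \<U> where "\<U> = {U. open U \<and> (AE w in lebesgue. w \<in> U \<longrightarrow> f w = 0)}"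
  obtain \<V> where V: "\<V> \<subseteq> \<U>" "countable \<V>" "\<Union>\<V> = \<Union>\<U>"
    using Lindelof[of \<U>] unfolding \<U>_def by auto
  have "AE w in lebesgue. \<forall>U\<in>\<V>. w \<in> U \<longrightarrow> f w = 0"
    using V(1,2) unfolding \<U>_def by (subst AE_ball_countable) auto
  then show ?thesis
  proof eventually_elim
    case (elim w)
    then show ?case using V(3) unfolding ess_support_def \<U>_def[symmetric] by auto
  qed
qed

lemma M_low_spectrally_supported:
  assumes "x \<in> M_low \<Omega> \<epsilon>" shows "spectrally_supported {w. \<epsilon> \<le> \<bar>\<bar>w\<bar> - \<Omega>\<bar>} x"
proof -
  obtain \<omega> c Xc where x: "represents \<omega> c Xc x" "\<And>k. \<bar>\<omega> k\<bar> \<le> \<Omega> - \<epsilon>" "ess_support Xc \<subseteq> {- \<Omega> + \<epsilon>..\<Omega> - \<epsilon>}"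
    using assms unfolding M_low_def by blast
  have "{- \<Omega> + \<epsilon>..\<Omega> - \<epsilon>} \<subseteq> {w. \<epsilon> \<le> \<bar>\<bar>w\<bar> - \<Omega>\<bar>}" by auto
  then have "AE w in lebesgue. w \<notin> {w. \<epsilon> \<le> \<bar>\<bar>w\<bar> - \<Omega>\<bar>} \<longrightarrow> Xc w = 0"
    using AE_ess_support[of Xc] x(3) by (auto elim!: eventually_mono)
  moreover have "\<omega> k \<in> {w. \<epsilon> \<le> \<bar>\<bar>w\<bar> - \<Omega>\<bar>}" for k using x(2)[of k] by auto
  ultimately show ?thesis unfolding spectrally_supported_def using x(1) by blast
qed

lemma M_high_spectrally_supported:
  assumes "x \<in> M_high \<Omega> \<epsilon>" shows "spectrally_supported {w. \<epsilon> \<le> \<bar>\<bar>w\<bar> - \<Omega>\<bar>} x"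
proof -
  obtain \<omega> c Xc where x: "represents \<omega> c Xc x" "\<And>k. \<bar>\<omega> k\<bar> \<ge> \<Omega> + \<epsilon>" "ess_support Xc \<subseteq> {..- \<Omega> - \<epsilon>} \<union> {\<Omega> + \<epsilon>..}"
    using assms unfolding M_high_def by blast
  have "{..- \<Omega> - \<epsilon>} \<union> {\<Omega> + \<epsilon>..} \<subseteq> {w. \<epsilon> \<le> \<bar>\<bar>w\<bar> - \<Omega>\<bar>}" by auto
  then have "AE w in lebesgue. w \<notin> {w. \<epsilon> \<le> \<bar>\<bar>w\<bar> - \<Omega>\<bar>} \<longrightarrow> Xc w = 0"
    using AE_ess_support[of Xc] x(3) by (auto elim!: eventually_mono)
  moreover have "\<omega> k \<in> {w. \<epsilon> \<le> \<bar>\<bar>w\<bar> - \<Omega>\<bar>}" for k using x(2)[of k] by auto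
  ultimately show ?thesis unfolding spectrally_supported_def using x(1) by blast
qed

lemma integral_reflect_shift:
  fixes f :: "real \<Rightarrow> complex"
  shows "(LINT s|lebesgue. f (t - s)) = (LINT s|lebesgue. f s)"
  using lebesgue_integral_real_affine[of "-1" f t] by simp

lemma integrable_reflect_shift:
  fixes f :: "real \<Rightarrow> 'a :: euclidean_space"
  shows "integrable lebesgue f \<Longrightarrow> integrable lebesgue (\<lambda>s. f (t - s))"
  using lebesgue_integrable_real_affine[of f "-1" t] by simp

text \<open>A convolution acts on each oscillation as multiplication by the transform \<open>E\<close> of its kernel.\<close>

lemma convolution_eq_pairing:
  fixes e x :: "real \<Rightarrow> complex"
  assumes rep: "represents \<omega> c Xc x" and e: "integrable lebesgue e"
  defines "E \<equiv> \<lambda>w. LINT u|lebesgue. exp (- \<i> * of_real (w * u)) * e u"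
  shows "(LINT s|lebesgue. e (t - s) * x s)
    = 1 / (2 * of_real pi) * spectral_data.pairing \<omega> c Xc (\<lambda>w. exp (\<i> * of_real (w * t)) * E w)"
proof -
  interpret X: spectral_data \<omega> c Xc using rep by (rule represents_spectral_data)
  have es: "integrable lebesgue (\<lambda>s. e (t - s))" using e by (rule integrable_reflect_shift)
  define H where "H s w = e (t - s) * exp (\<i> * complex_of_real (w * s))" for s w
  have inner: "(LINT s|lebesgue. H s w) = exp (\<i> * of_real (w * t)) * E w" for w
  proof -
    have "H s w = exp (\<i> * of_real (w * t)) * (exp (- \<i> * of_real (w * (t - s))) * e (t - s))" for s
      by (simp add: H_def algebra_simps flip: exp_add)
    then have "(LINT s|lebesgue. H s w) = exp (\<i> * of_real (w * t)) * (LINT s|lebesgue. exp (- \<i> * of_real (w * (t - s))) * e (t - s))"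
      by (simp only: integral_mult_right_zero)
    also have "(LINT s|lebesgue. exp (- \<i> * of_real (w * (t - s))) * e (t - s)) = E w"
      unfolding E_def by (rule integral_reflect_shift[of "\<lambda>u. exp (- \<i> * of_real (w * u)) * e u"])
    finally show ?thesis .
  qed
  have "X.pairing (\<lambda>w. LINT s|lebesgue. H s w) = (LINT s|lebesgue. X.pairing (H s))"
  proof (rule X.pairing_exchange[OF sigma_finite_lebesgue])
    have 1: "(\<lambda>(s, w). exp (\<i> * complex_of_real (w * s))) \<in> borel_measurable (lebesgue \<Otimes>\<^sub>M borel)"
      by (rule borel_measurable_lebesgue_pair) measurable
    show "(\<lambda>(s, w). H s w) \<in> borel_measurable (lebesgue \<Otimes>\<^sub>M borel)"
      unfolding H_def using 1 borel_measurable_integrable[OF es] by measurable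
    show "(\<integral>\<^sup>+s. ennreal (norm (H s w)) \<partial>lebesgue) \<le> ennreal (LINT s|lebesgue. norm (e (t - s)))" for w
      using nn_integral_eq_integral[OF integrable_norm[OF es]] by (simp add: H_def norm_mult)
    show "norm (H s w) \<le> norm (e (t - s))" for s w
      by (simp add: H_def norm_mult)
  qed
  moreover have "X.pairing (H s) = 2 * of_real pi * (e (t - s) * x s)" for s
    unfolding H_def represents_eq_pairing[OF rep, of s]
    by (subst X.pairing_cmult[where B = 1]) auto
  ultimately show ?thesis
    unfolding inner by simp
qed

text \<open>The gap of \<open>D\<close> at \<open>\<Omega>\<close> is where the poles cross the imaginary axis, and the symmetry of \<open>D\<close> makes a
real predicting kernel possible. That kernel is chosen before the process, which gives uniformity.\<close>

lemma weakly_predictable_of_support: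
  assumes D: "closed D" "\<Omega> \<notin> D" and sym: "\<And>w. w \<in> D \<Longrightarrow> - w \<in> D"
    and supp: "\<And>x. x \<in> \<X> \<Longrightarrow> spectrally_supported D x"
  shows "weakly_predictable \<Omega> \<X>"
  unfolding weakly_predictable_def
proof (intro conjI ballI allI impI)
  show "\<X> \<subseteq> M_inf"
    using supp unfolding spectrally_supported_def M_inf_def by blast
  fix k and \<eta> :: real assume k: "k \<in> anticausal_kernels \<Omega>" and \<eta>: "0 < \<eta>"
  note kF = anticausal_kernel_fourier[OF k D]
  obtain r where r: "\<And>w. w \<in> D \<Longrightarrow> norm ((LINT t|lebesgue. exp (- \<i> * of_real (w * t)) * of_real (k t))
       - (LINT t|lebesgue. exp (- \<i> * of_real (w * t)) * of_real (laguerre_kernel r t))) \<le> \<eta>"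
    using causal_approx_real[OF kF(2) sym \<eta>] by blast
  define kh where "kh = laguerre_kernel r"
  have kh_int: "integrable lebesgue kh" unfolding kh_def by (rule integrable_laguerre_kernel_real)
  define e where "e u = complex_of_real (k u - kh u)" for u
  have e_int: "integrable lebesgue e"
    unfolding e_def using kF(1) kh_int by auto
  define E where "E w = (LINT u|lebesgue. exp (- \<i> * of_real (w * u)) * e u)" for w
  have E_cont: "continuous_on UNIV E" unfolding E_def using e_int by (rule fourier_continuous)
  have E_bd: "norm (E w) \<le> (LINT u|lebesgue. norm (e u))" for w
    unfolding E_def using e_int by (rule fourier_norm_le)
  have E_le: "norm (E w) \<le> \<eta>" if "w \<in> D" for w
    using r[OF that] Bochner_Integration.integral_diff[OF integrable_modulated[OF integrable_of_real[OF kF(1)]]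
        integrable_modulated[OF integrable_of_real[OF kh_int]], of w w]
    by (simp add: E_def e_def right_diff_distrib kh_def)
  show "\<exists>kh\<in>causal_kernels. \<forall>x\<in>\<X>.
        (\<forall>t. set_integrable lebesgue {t..} (\<lambda>s. of_real (k (t - s)) * x s) \<and>
             set_integrable lebesgue {..t} (\<lambda>s. of_real (kh (t - s)) * x s)) \<and>
        (\<forall>X. is_spectrum x X \<longrightarrow>
           L_norm \<infinity> (\<lambda>t. anticausal_conv k x t - causal_conv kh x t) \<le> ereal (\<eta> * norm X))"
  proof (intro bexI[of _ kh] ballI conjI allI impI)
    show "kh \<in> causal_kernels" unfolding kh_def by (rule laguerre_kernel_causal)
    fix x assume "x \<in> \<X>"
    then obtain \<omega> c Xc where rep: "represents \<omega> c Xc x" and \<omega>: "\<And>k. \<omega> k \<in> D"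
      and Xc: "AE w in lebesgue. w \<notin> D \<longrightarrow> Xc w = 0"
      using supp unfolding spectrally_supported_def by blast
    interpret X: spectral_data \<omega> c Xc using rep by (rule represents_spectral_data)
    have x_eq: "x t = 1 / (2 * of_real pi) * X.pairing (\<lambda>w. exp (\<i> * of_real (w * t)))" for t
      using rep by (rule represents_eq_pairing)
    have [measurable]: "x \<in> borel_measurable borel"
    proof -
      have "(\<lambda>t. X.pairing (\<lambda>w. exp (\<i> * of_real (w * t)))) \<in> borel_measurable borel"
        by (rule X.pairing_measurable[where B' = "\<lambda>_. 1"]) auto
      then show ?thesis unfolding x_eq[abs_def] by measurable
    qed
    obtain B where x_bd: "\<And>t. norm (x t) \<le> B"
    proof
      fix t
      show "norm (x t) \<le> 1 / (2 * pi) * (1 * ((\<Sum>k. norm (c k)) + (LINT w|lebesgue. norm (Xc w))))"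
        unfolding x_eq norm_mult
        by (intro mult_mono X.pairing_norm_le) (auto simp: norm_mult norm_divide intro!: borel_measurable_lebesgueI)
    qed
    have conv_int: "integrable lebesgue (\<lambda>s. complex_of_real (g (t - s)) * x s)" if "integrable lebesgue g" for g t
    proof (rule Bochner_Integration.integrable_bound)
      have gs: "integrable lebesgue (\<lambda>s. g (t - s))" using that by (rule integrable_reflect_shift)
      then show "integrable lebesgue (\<lambda>s. B * norm (g (t - s)))" by simp
      have "x \<in> borel_measurable lebesgue" by (rule borel_measurable_lebesgueI) measurable
      then show "(\<lambda>s. complex_of_real (g (t - s)) * x s) \<in> borel_measurable lebesgue"
        using borel_measurable_integrable[OF gs] by measurable
      have "B \<ge> 0" using x_bd[of 0] norm_ge_zero order_trans by blast
      then show "AE s in lebesgue. norm (complex_of_real (g (t - s)) * x s) \<le> norm (B * norm (g (t - s)))"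
        using x_bd by (auto simp: norm_mult mult.commute intro!: mult_right_mono)
    qed
    have set_int: "set_integrable lebesgue S (\<lambda>s. complex_of_real (g (t - s)) * x s)"
      if "integrable lebesgue g" "S \<in> sets lebesgue" for g t S
      unfolding set_integrable_def using that by (intro integrable_mult_indicator conv_int)
    show "set_integrable lebesgue {t..} (\<lambda>s. of_real (k (t - s)) * x s)" for t
      by (rule set_int[OF kF(1)]) simp
    show "set_integrable lebesgue {..t} (\<lambda>s. of_real (kh (t - s)) * x s)" for t
      by (rule set_int[OF kh_int]) simp
    \<comment> \<open>one-sidedness extends both convolution integrals to the whole line\<close>
    have k0: "k u = 0" if "u > 0" for u using k that unfolding anticausal_kernels_def by blast
    have kh0: "kh u = 0" if "u < 0" for u using that by (simp add: kh_def laguerre_kernel_def)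
    have diff: "anticausal_conv k x t - causal_conv kh x t
        = 1 / (2 * of_real pi) * X.pairing (\<lambda>w. exp (\<i> * of_real (w * t)) * E w)" for t
    proof -
      have "anticausal_conv k x t = (LINT s|lebesgue. of_real (k (t - s)) * x s)"
        unfolding anticausal_conv_def set_lebesgue_integral_def
        by (intro Bochner_Integration.integral_cong) (auto simp: indicator_def k0)
      moreover have "causal_conv kh x t = (LINT s|lebesgue. of_real (kh (t - s)) * x s)"
        unfolding causal_conv_def set_lebesgue_integral_def
        by (intro Bochner_Integration.integral_cong) (auto simp: indicator_def kh0)
      ultimately have "anticausal_conv k x t - causal_conv kh x t = (LINT s|lebesgue. e (t - s) * x s)"
        using Bochner_Integration.integral_diff[OF conv_int[OF kF(1)] conv_int[OF kh_int], of t t]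
        by (simp add: e_def left_diff_distrib)
      also note convolution_eq_pairing[OF rep e_int, of t, folded E_def]
      finally show ?thesis .
    qed
    fix X assume X: "is_spectrum x X"
    have bound: "norm (anticausal_conv k x t - causal_conv kh x t) \<le> \<eta> * norm X" for t
    proof -
      define F where "F w = exp (\<i> * of_real (w * t)) * E w" for w
      \<comment> \<open>cut down to norm at most \<open>\<eta>\<close>, unchanged on \<open>D\<close>; off \<open>D\<close> the values of \<open>F\<close> may be large\<close>
      define f where "f w = F w * of_real (\<eta> / max \<eta> (norm (F w)))" for w
      have norm_F: "norm (F w) = norm (E w)" for w by (simp add: F_def norm_mult)
      have f_cont: "continuous_on UNIV f"
        unfolding f_def F_def using \<eta> by (intro continuous_intros E_cont) auto
      have f_le: "norm (f w) \<le> \<eta>" for w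
        using \<eta> by (simp add: f_def norm_mult norm_divide divide_le_eq mult.commute mult_left_mono)
      have f_D: "f w = F w" if "w \<in> D" for w
        using E_le[OF that] \<eta> by (simp add: f_def norm_F max_absorb1)
      have "X.pairing F = X.pairing f"
      proof -
        have F_cont: "continuous_on UNIV F" unfolding F_def by (intro continuous_intros E_cont)
        note [measurable] = borel_measurable_lebesgueI[OF borel_measurable_continuous_onI[OF F_cont]]
          borel_measurable_lebesgueI[OF borel_measurable_continuous_onI[OF f_cont]]
        have "(LINT w|lebesgue. F w * Xc w) = (LINT w|lebesgue. f w * Xc w)"
          by (rule integral_cong_AE) (use Xc f_D in \<open>auto elim!: eventually_mono\<close>)
        then show ?thesis using f_D[OF \<omega>] by (simp add: X.pairing_def)
      qed
      also have "norm \<dots> \<le> norm X * \<eta>"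
        using rep X f_cont f_le by (rule is_spectrum_pairing)
      finally have F: "norm (X.pairing F) \<le> norm X * \<eta>" .
      have "norm (anticausal_conv k x t - causal_conv kh x t) = 1 / (2 * pi) * norm (X.pairing F)"
        unfolding diff F_def by (simp add: norm_mult norm_divide)
      also have "\<dots> \<le> 1 * (norm X * \<eta>)"
        using F pi_gt3 by (intro mult_mono) auto
      finally show ?thesis by (simp add: mult.commute)
    qed
    have meas: "(\<lambda>t. anticausal_conv k x t - causal_conv kh x t) \<in> borel_measurable lebesgue"
    proof (rule borel_measurable_lebesgueI)
      have [measurable]: "E \<in> borel_measurable borel" using E_cont by (rule borel_measurable_continuous_onI)
      have "(\<lambda>t. X.pairing (\<lambda>w. exp (\<i> * of_real (w * t)) * E w)) \<in> borel_measurable borel"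
        by (rule X.pairing_measurable[where B' = "\<lambda>_. LINT u|lebesgue. norm (e u)"]) (auto simp: norm_mult E_bd)
      then show "(\<lambda>t. anticausal_conv k x t - causal_conv kh x t) \<in> borel_measurable borel"
        unfolding diff by measurable
    qed
    have "esssup lebesgue (\<lambda>t. ereal (norm (anticausal_conv k x t - causal_conv kh x t))) \<le> ereal (\<eta> * norm X)"
    proof (rule esssup_I)
      show "(\<lambda>t. ereal (norm (anticausal_conv k x t - causal_conv kh x t))) \<in> borel_measurable lebesgue"
        by (rule borel_measurable_ereal[OF measurable_compose[OF meas borel_measurable_norm]])
    qed (simp add: bound)
    then show "L_norm \<infinity> (\<lambda>t. anticausal_conv k x t - causal_conv kh x t) \<le> ereal (\<eta> * norm X)"
      unfolding L_norm_def using meas by simp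
  qed
qed

theorem theorem2:
  fixes \<Omega> \<epsilon> :: real
  assumes "0 < \<Omega>" and "0 < \<epsilon>" and "\<epsilon> < \<Omega>"
  shows "weakly_predictable \<Omega> (M_low \<Omega> \<epsilon>) \<and> weakly_predictable \<Omega> (M_high \<Omega> \<epsilon>)"
proof -
  define D where "D = {w. \<epsilon> \<le> \<bar>\<bar>w\<bar> - \<Omega>\<bar>}"
  have "closed D" unfolding D_def by (intro closed_Collect_le continuous_intros)
  moreover have "\<Omega> \<notin> D" using assms by (simp add: D_def)
  moreover have "- w \<in> D" if "w \<in> D" for w using that by (simp add: D_def)
  ultimately have *: "weakly_predictable \<Omega> \<X>" if "\<And>x. x \<in> \<X> \<Longrightarrow> spectrally_supported D x" for \<X>
    using that by (rule weakly_predictable_of_support)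
  show ?thesis
    using *[OF M_low_spectrally_supported[of _ \<Omega> \<epsilon>, folded D_def]]
      *[OF M_high_spectrally_supported[of _ \<Omega> \<epsilon>, folded D_def]] by simp
qed

end
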